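(* There exists an absolute constant $C>0$ such that for all integers $n,t,k\geq 2$, the number of antichains of $[t]^n$ of size at most $\frac{1}{k}\cdot \alpha(t,n)$ is at most $$\exp_2\left(C\cdot\frac{\log k}{k}\cdot \alpha(t,n)\right).$$
   Context: For an integer $t\geq 2$ write $[t]=\{0,1,\dots,t-1\}$. The hypergrid $[t]^n$ is the poset on $[t]^n$ with the coordinate-wise order: $x\preceq y$ iff $x(i)\leq y(i)$ for all $i$. $\alpha(t,n)$ denotes the maximum size of an antichain in $[t]^n$. $\exp_2(x)=2^x$. *)

theory Defs
  imports Complex_Main "HOL-Library.FuncSet"
begin

definition hypergrid :: "nat \<Rightarrow> nat \<Rightarrow> (nat \<Rightarrow> nat) set" where
  "hypergrid t n = {..<n} \<rightarrow>\<^sub>E {..<t}"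

definition grid_le :: "nat \<Rightarrow> (nat \<Rightarrow> nat) \<Rightarrow> (nat \<Rightarrow> nat) \<Rightarrow> bool" where
  "grid_le n x y \<longleftrightarrow> (\<forall>i<n. x i \<le> y i)"

definition grid_antichains :: "nat \<Rightarrow> nat \<Rightarrow> (nat \<Rightarrow> nat) set set" where
  "grid_antichains t n =
     {A. A \<subseteq> hypergrid t n \<and> (\<forall>x\<in>A. \<forall>y\<in>A. x \<noteq> y \<longrightarrow> \<not> grid_le n x y)}"

definition grid_width :: "nat \<Rightarrow> nat \<Rightarrow> nat" where
  "grid_width t n = Max (card ` grid_antichains t n)"

lemma finite_hypergrid: "finite (hypergrid t n)"
  by (simp add: hypergrid_def finite_PiE)

lemma finite_grid_antichains: "finite (grid_antichains t n)"
  by (rule finite_subset[of _ "Pow (hypergrid t n)"])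
     (auto simp: grid_antichains_def finite_hypergrid)

lemma empty_in_grid_antichains: "{} \<in> grid_antichains t n"
  by (simp add: grid_antichains_def)

lemma grid_width_attained: "\<exists>A\<in>grid_antichains t n. card A = grid_width t n"
proof -
  have "grid_width t n \<in> card ` grid_antichains t n"
    unfolding grid_width_def
    using finite_grid_antichains[of t n] empty_in_grid_antichains[of t n] by (intro Max_in) auto
  then show ?thesis by auto
qed

lemma card_le_grid_width: "A \<in> grid_antichains t n \<Longrightarrow> card A \<le> grid_width t n"
  unfolding grid_width_def using finite_grid_antichains by (intro Max_ge) auto

end

theory Submission
  imports Defs "HOL-Analysis.Analysis"
begin

text \<open>
  Write \<open>\<alpha>\<close> for the width. The proof rests on superlinear supersaturation: a set of
  \<open>K\<alpha>\<close> points, \<open>K\<close> large, contains a point comparable to \<open>\<Omega>(K\<^bsup>5/4\<^esup>)\<close> others. To see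
  this, partition the grid into few chains in \<open>M \<approx> \<surd>K\<close> essentially disjoint ways, so that a
  comparable pair shares a chain in at most one of them. If \<open>n \<ge> M\<close>, split the coordinates
  into \<open>M\<close> blocks and use a symmetric chain decomposition inside one block, fixing the other
  coordinates; since \<open>\<alpha> = \<Theta>(t\<^bsup>n-1\<^esup>/\<surd>n)\<close>, this needs only \<open>O(\<surd>M \<alpha>)\<close> chains.
  If \<open>n < M\<close>, use parallel staircases of \<open>M\<close> different slopes in the plane of two coordinates.

  Removing a vertex of degree \<open>d\<close> gives \<open>Z(F) \<le> Z(F - x) + \<mu> Z(F - x - N(x))\<close> for the
  generating function \<open>Z(F) = \<Sum> \<mu>\<^bsup>|A|\<^esup>\<close> over the antichains \<open>A\<close> in \<open>F\<close>. With
  \<open>\<mu> = k\<^bsup>-9\<^esup>\<close> and the degrees above this yields \<open>Z = exp (O(\<alpha>/k))\<close>, and the number of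
  antichains of size at most \<open>\<alpha>/k\<close> is at most \<open>\<mu>\<^bsup>-\<alpha>/k\<^esup> Z\<close>.
\<close>

section \<open>Symmetric chains in the hypergrid\<close>

text \<open>
  The usual inductive symmetric chain decomposition, in coordinates: the label identifies the chain
  through \<open>x\<close>, and the sum of its entries is the rank of the lowest point of that chain. A chain of
  length \<open>l\<close> times \<open>[t]\<close> splits into L-shaped chains, and the point at distance \<open>D\<close> from the top
  of the chain and height \<open>v\<close> in \<open>[t]\<close> lies in the one numbered \<open>min v D\<close>.
\<close>

primrec chain_label :: "nat \<Rightarrow> nat \<Rightarrow> (nat \<Rightarrow> nat) \<Rightarrow> nat list" where
  "chain_label t 0 x = []"
| "chain_label t (Suc n) x =
     min (x n) (n * (t - 1) - sum_list (chain_label t n x) - (\<Sum>i<n. x i)) # chain_label t n x"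

text \<open>The second bound makes the truncated subtractions in \<open>chain_label\<close> exact.
  Together the bounds place \<open>x\<close> between the bottom rank of its chain and the mirror
  image of that rank.\<close>

lemma chain_label_sum_bounds:
  assumes "\<And>i. i < n \<Longrightarrow> x i < t"
  shows "sum_list (chain_label t n x) \<le> (\<Sum>i<n. x i)"
    and "sum_list (chain_label t n x) + (\<Sum>i<n. x i) \<le> n * (t - 1)"
proof -
  have "sum_list (chain_label t n x) \<le> (\<Sum>i<n. x i) \<and>
        sum_list (chain_label t n x) + (\<Sum>i<n. x i) \<le> n * (t - 1)"
    using assms
  proof (induction n)
    case (Suc n)
    have "x n \<le> t - 1" using Suc.prems[of n] by simp
    then show ?case using Suc.IH Suc.prems by (simp add: less_Suc_eq) linarith
  qed simp
  then show "sum_list (chain_label t n x) \<le> (\<Sum>i<n. x i)"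
    and "sum_list (chain_label t n x) + (\<Sum>i<n. x i) \<le> n * (t - 1)" by auto
qed

text \<open>Equal labels mean equal values of \<open>min v D\<close>. If the rank of the prefix and
  the last coordinate moved in opposite directions, \<open>D\<close> and \<open>v\<close> would move
  strictly in the same direction, and so would their minimum.\<close>

lemma chain_label_eq_imp_grid_le:
  assumes "\<And>i. i < n \<Longrightarrow> x i < t" "\<And>i. i < n \<Longrightarrow> y i < t"
    and "chain_label t n x = chain_label t n y" and "(\<Sum>i<n. x i) \<le> (\<Sum>i<n. y i)"
  shows "grid_le n x y"
  using assms
proof (induction n)
  case 0
  then show ?case by (simp add: grid_le_def)
next
  case (Suc n)
  let ?l = "sum_list (chain_label t n x)" and ?X = "\<Sum>i<n. x i" and ?Y = "\<Sum>i<n. y i"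
  have lab: "chain_label t n x = chain_label t n y"
    and s: "min (x n) (n * (t - 1) - ?l - ?X) = min (y n) (n * (t - 1) - ?l - ?Y)"
    using Suc.prems(3) by auto
  have "?l + ?X \<le> n * (t - 1)" "?l + ?Y \<le> n * (t - 1)"
    using chain_label_sum_bounds(2)[of n x t] chain_label_sum_bounds(2)[of n y t] Suc.prems(1,2) lab by auto
  moreover have "?X + x n \<le> ?Y + y n" using Suc.prems(4) by simp
  ultimately have "?X \<le> ?Y \<and> x n \<le> y n"
    using s by (cases "?X \<le> ?Y") linarith+
  then show ?case
    using Suc.IH[OF _ _ lab] Suc.prems(1,2) by (auto simp: grid_le_def less_Suc_eq)
qed

text \<open>The chain skips no rank between its symmetric ends. In the induction it is an L: on one
  leg the last coordinate stays at \<open>s\<close> while the prefix climbs to distance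
  \<open>s\<close> from the top of its own chain; on the other the prefix rests there and the last
  coordinate climbs.\<close>

lemma chain_label_class_meets_rank:
  assumes "\<And>i. i < n \<Longrightarrow> x i < t"
    and "sum_list (chain_label t n x) \<le> r" and "sum_list (chain_label t n x) + r \<le> n * (t - 1)"
  shows "\<exists>y\<in>hypergrid t n. chain_label t n y = chain_label t n x \<and> (\<Sum>i<n. y i) = r"
  using assms
proof (induction n arbitrary: r)
  case 0
  then show ?case by (auto simp: hypergrid_def)
next
  case (Suc n)
  let ?l = "sum_list (chain_label t n x)" and ?X = "\<Sum>i<n. x i"
  define s where "s = min (x n) (n * (t - 1) - ?l - ?X)"
  have xb: "\<And>i. i < n \<Longrightarrow> x i < t" using Suc.prems(1) by simp
  have xn: "x n \<le> t - 1" "0 < t" using Suc.prems(1)[of n] by auto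
  note b = chain_label_sum_bounds[of n x t, OF xb]
  have r: "s + ?l \<le> r" "s + ?l + r \<le> (t - 1) + n * (t - 1)"
    using Suc.prems(2,3) by (auto simp: s_def)
  have sD: "s + ?l + ?X \<le> n * (t - 1)" "s \<le> t - 1"
    using b xn by (auto simp: s_def)
  have extend: ?case
    if r': "?l \<le> r'" "?l + r' \<le> n * (t - 1)" and v: "v \<le> t - 1" "r' + v = r"
      and sv: "s = min v (n * (t - 1) - ?l - r')" for r' v
  proof -
    obtain y where y: "y \<in> hypergrid t n" "chain_label t n y = chain_label t n x" "(\<Sum>i<n. y i) = r'"
      using Suc.IH[OF xb r'] by auto
    have cong: "chain_label t m (y(n := v)) = chain_label t m y" if "m \<le> n" for m
      using that by (induction m) auto
    have "y(n := v) \<in> hypergrid t (Suc n)"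
      using y(1) v(1) xn(2) by (auto simp: hypergrid_def PiE_iff extensional_def less_Suc_eq)
    moreover have "chain_label t (Suc n) (y(n := v)) = chain_label t (Suc n) x"
      using y cong[of n] sv by (simp add: s_def)
    moreover have "(\<Sum>i<Suc n. (y(n := v)) i) = r" using y v by simp
    ultimately show ?case by blast
  qed
  show ?case
  proof (cases "?l + r \<le> n * (t - 1)")
    case True
    then show ?thesis using r sD by (intro extend[of "r - s" s]) auto
  next
    case False
    then show ?thesis
      using r sD b by (intro extend[of "n * (t - 1) - ?l - s" "r - (n * (t - 1) - ?l - s)"]) auto
  qed
qed

section \<open>Layers of the grid and the number of symmetric chains\<close>

definition grid_layer :: "nat \<Rightarrow> nat \<Rightarrow> nat \<Rightarrow> (nat \<Rightarrow> nat) set" where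
  "grid_layer t n s = {x \<in> hypergrid t n. (\<Sum>i<n. x i) = s}"

lemma finite_grid_layer: "finite (grid_layer t n s)"
  by (simp add: grid_layer_def finite_hypergrid)

lemma hypergrid_less: "x \<in> hypergrid t n \<Longrightarrow> i < n \<Longrightarrow> x i < t"
  by (auto simp: hypergrid_def PiE_iff)

lemma hypergrid_eqI:
  assumes "x \<in> hypergrid t n" "y \<in> hypergrid t n" "\<And>i. i < n \<Longrightarrow> x i = y i"
  shows "x = y"
  using assms by (auto simp: hypergrid_def intro!: PiE_ext[of x "{..<n}" "\<lambda>_. {..<t}" y])

text \<open>Each chain is symmetric about the middle rank, hence meets the middle layer, so every
  label is already attained there.\<close>

lemma card_chain_labels_le:
  "card (chain_label t n ` hypergrid t n) \<le> card (grid_layer t n (n * (t - 1) div 2))"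
proof -
  have "chain_label t n ` hypergrid t n \<subseteq> chain_label t n ` grid_layer t n (n * (t - 1) div 2)"
  proof
    fix l assume "l \<in> chain_label t n ` hypergrid t n"
    then obtain x where x: "x \<in> hypergrid t n" "l = chain_label t n x" by auto
    note b = chain_label_sum_bounds[of n x t, OF hypergrid_less[OF x(1)]]
    have "sum_list l \<le> n * (t - 1) div 2" "sum_list l + n * (t - 1) div 2 \<le> n * (t - 1)"
      using b x(2) by auto
    from chain_label_class_meets_rank[of n x t, OF hypergrid_less[OF x(1)] this[unfolded x(2)]]
    obtain y where "y \<in> hypergrid t n" "chain_label t n y = l" "(\<Sum>i<n. y i) = n * (t - 1) div 2"
      using x(2) by auto
    then show "l \<in> chain_label t n ` grid_layer t n (n * (t - 1) div 2)"
      by (force simp: grid_layer_def)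
  qed
  then show ?thesis
    using finite_grid_layer by (meson card_image_le card_mono finite_imageI le_trans)
qed

section \<open>The size of a layer\<close>

text \<open>Only central coefficients matter. The even case is an induction on their ratio, closed
  by \<open>sqrt a * sqrt (a + 2) \<le> a + 1\<close>; for odd \<open>m\<close>, twice the central
  coefficient is the next even one.\<close>

lemma choose_le_central: "real (m choose k) \<le> 2 ^ m / sqrt (real (m + 1))"
proof -
  have even: "real ((2*j) choose j) \<le> 4 ^ j / sqrt (real (2*j + 1))" for j
  proof (induction j)
    case (Suc j)
    have "real (2 * Suc j choose Suc j) * (real j + 1) = 2 * (2 * real j + 1) * real ((2*j) choose j)"
    proof -
      have a: "Suc j * (2 * Suc j choose Suc j) = (2 * Suc j) * (Suc (2*j) choose j)"
        using Suc_times_binomial_eq[of "Suc (2*j)" j] by (simp add: mult.commute)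
      have "Suc (2*j) choose j = Suc (2*j) choose Suc j"
        using binomial_symmetric[of j "Suc (2*j)"] by (simp add: Suc_diff_le)
      then have b: "Suc j * (Suc (2*j) choose j) = Suc (2*j) * ((2*j) choose j)"
        using Suc_times_binomial_eq[of "2*j" j] by (simp add: mult.commute)
      from a have "Suc j * (2 * Suc j choose Suc j) = 2 * (Suc j * (Suc (2*j) choose j))" by simp
      then have "Suc j * (2 * Suc j choose Suc j) = 2 * (Suc (2*j) * ((2*j) choose j))" using b by simp
      then have "real (Suc j * (2 * Suc j choose Suc j)) = real (2 * (Suc (2*j) * ((2*j) choose j)))"
        by (simp only:)
      then show ?thesis unfolding of_nat_mult by (simp add: algebra_simps del: binomial_Suc_Suc)
    qed
    then have eq: "real (2 * Suc j choose Suc j) = 2 * (2 * real j + 1) * real ((2*j) choose j) / (real j + 1)"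
      by (simp add: field_simps)
    define a where "a = 2 * real j + 1"
    have a: "a \<ge> 1" "real j + 1 = (a + 1) / 2" by (auto simp: a_def field_simps)
    have "sqrt a * sqrt (a + 2) \<le> a + 1"
      unfolding real_sqrt_mult[symmetric] by (rule real_le_lsqrt) (use a in \<open>auto simp: power2_eq_square algebra_simps\<close>)
    then have key: "a / (a + 1) / sqrt a \<le> 1 / sqrt (a + 2)"
    proof -
      have "a / (a+1) / sqrt a = a / sqrt a / (a + 1)" by (simp add: mult.commute)
      also have "\<dots> = sqrt a / (a + 1)" using a by (simp add: real_div_sqrt)
      also have "\<dots> \<le> 1 / sqrt (a + 2)" using a \<open>sqrt a * sqrt (a + 2) \<le> a + 1\<close> by (simp add: field_simps)
      finally show ?thesis .
    qed
    have "real (2 * Suc j choose Suc j) = 4 * (a / (a + 1)) * real ((2*j) choose j)"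
      unfolding eq a(2) by (simp add: a_def field_simps)
    also have "\<dots> \<le> 4 * (a / (a + 1)) * (4 ^ j / sqrt a)"
      using Suc a by (intro mult_left_mono) (auto simp: a_def add.commute)
    also have "\<dots> = 4 ^ Suc j * (a / (a + 1) / sqrt a)" by simp
    also have "\<dots> \<le> 4 ^ Suc j * (1 / sqrt (a + 2))" using key by (intro mult_left_mono) auto
    finally show ?case by (simp add: a_def add_ac)
  qed simp
  have max: "real (m choose k) \<le> real (m choose (m div 2))"
    using binomial_maximum[of m k] by simp
  show ?thesis
  proof (cases "even m")
    case True
    then obtain j where "m = 2 * j" by auto
    then show ?thesis using max even[of j] by (simp add: power_mult)
  next
    case False
    then obtain j where j: "m = 2 * j + 1" by (auto elim: oddE)
    have "2 * (Suc (2*j) choose j) = (2 * Suc j choose Suc j)"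
      using binomial_symmetric[of j "Suc (2*j)"] by (simp add: Suc_diff_le)
    then have "2 * real (m choose (m div 2)) = real (2 * Suc j choose Suc j)"
      using j by (metis (no_types, lifting) Suc_eq_plus1 add_diff_cancel_right' bit_eq_rec even_add even_mult_iff even_two_times_div_two odd_two_times_div_two_succ of_nat_mult of_nat_numeral nat_mult_eq_cancel1 zero_less_numeral False)
    also have "\<dots> \<le> 4 ^ Suc j / sqrt (real (2 * Suc j + 1))" by (rule even)
    also have "\<dots> \<le> 4 ^ Suc j / sqrt (real (m + 1))"
      by (intro divide_left_mono) (auto simp: j)
    finally show ?thesis using max by (simp add: j power_mult)
  qed
qed

text \<open>Deleting one coordinate is injective: the others and the residue of the sum fix it
  modulo \<open>u\<close>, and it is below \<open>u\<close>.\<close>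

lemma card_PiE_sum_mod_le:
  fixes u :: nat
  assumes "finite I" "I \<noteq> {}"
  shows "card {U \<in> I \<rightarrow>\<^sub>E {..<u}. (\<Sum>i\<in>I. U i) mod u = s} \<le> u ^ (card I - 1)"
proof -
  obtain a where a: "a \<in> I" using assms by auto
  let ?S = "{U \<in> I \<rightarrow>\<^sub>E {..<u}. (\<Sum>i\<in>I. U i) mod u = s}"
  have "inj_on (\<lambda>U. restrict U (I - {a})) ?S"
  proof (rule inj_onI)
    fix U V assume U: "U \<in> ?S" and V: "V \<in> ?S" and eq: "restrict U (I - {a}) = restrict V (I - {a})"
    have e: "U i = V i" if "i \<in> I - {a}" for i
      using fun_cong[OF eq, of i] that by simp
    have "(\<Sum>i\<in>I - {a}. U i) = (\<Sum>i\<in>I - {a}. V i)" using e by (intro sum.cong) auto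
    moreover have "(U a + (\<Sum>i\<in>I - {a}. U i)) mod u = (V a + (\<Sum>i\<in>I - {a}. V i)) mod u"
      using U V sum.remove[OF assms(1) a, of U] sum.remove[OF assms(1) a, of V] by simp
    ultimately have "U a mod u = V a mod u" by (auto simp: nat_mod_eq_iff)
    then have "U a = V a" using U V a by (auto simp: PiE_iff)
    then show "U = V" using e U V by (auto intro!: PiE_ext[of U I "\<lambda>_. {..<u}" V])
  qed
  moreover have "(\<lambda>U. restrict U (I - {a})) ` ?S \<subseteq> (I - {a}) \<rightarrow>\<^sub>E {..<u}"
    by (auto simp: PiE_iff split: if_splits)
  ultimately have "card ?S \<le> card ((I - {a}) \<rightarrow>\<^sub>E {..<u})"
    using assms by (intro card_inj_on_le[of "\<lambda>U. restrict U (I - {a})"]) (auto intro: finite_PiE)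
  also have "\<dots> = u ^ (card I - 1)" using assms a by (simp add: card_PiE)
  finally show ?thesis .
qed

lemma restrict_eqD: "restrict f A = restrict g A \<Longrightarrow> i \<in> A \<Longrightarrow> f i = g i"
  by (metis restrict_apply')

text \<open>
  On \<open>I\<close> write \<open>x = U + uB\<close> with \<open>0 \<le> U < u\<close> and \<open>B \<in> {0,1}\<close>. The rank determines \<open>\<Sum> U\<close>
  modulo \<open>u\<close>, which saves a factor \<open>u\<close>, and then the size of \<open>B\<close>, which saves a square root.
\<close>

lemma card_grid_layer_pattern_le:
  fixes u :: nat
  assumes u: "1 \<le> u" and t: "t \<le> 2 * u + 1" and I: "I \<subseteq> {..<N}" "I \<noteq> {}"
  shows "real (card {x \<in> grid_layer t N s. {i. i < N \<and> x i < 2 * u} = I})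
    \<le> real u ^ (card I - 1) * (2 ^ card I / sqrt (real (card I + 1)))"
proof -
  let ?Y = "{x \<in> grid_layer t N s. {i. i < N \<and> x i < 2 * u} = I}"
  let ?U = "{U \<in> I \<rightarrow>\<^sub>E {..<u}. (\<Sum>i\<in>I. U i) mod u = s mod u}"
  \<comment> \<open>Off \<open>I\<close> every coordinate equals \<open>2 * u\<close>. Once the
    residues \<open>U\<close> are known, the rank leaves a multiple of \<open>u\<close>, whose
    quotient \<open>e U\<close> is the number of coordinates in \<open>I\<close> that are at least
    \<open>u\<close>.\<close>
  define e where "e U = (s - 2 * u * card ({..<N} - I) - (\<Sum>i\<in>I. U i)) div u" for U :: "nat \<Rightarrow> nat"
  define g where "g x = (restrict (\<lambda>i. x i mod u) I, {i \<in> I. u \<le> x i})" for x :: "nat \<Rightarrow> nat"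
  have fI: "finite I" using I finite_subset by blast
  have on: "x i = x i mod u + (if u \<le> x i then u else 0)" if "x \<in> ?Y" "i \<in> I" for x i
  proof -
    have "x i < 2 * u" using that by auto
    then show ?thesis by (cases "u \<le> x i") (auto simp: le_mod_geq)
  qed
  have off: "x i = 2 * u" if "x \<in> ?Y" "i < N" "i \<notin> I" for x i
  proof -
    have "x i < t" "\<not> x i < 2 * u" using that by (auto simp: grid_layer_def hypergrid_less)
    then show ?thesis using t by simp
  qed
  have sum: "(\<Sum>i\<in>I. x i mod u) + u * card {i \<in> I. u \<le> x i} + 2 * u * card ({..<N} - I) = s" if x: "x \<in> ?Y" for x
  proof -
    have "s = (\<Sum>i\<in>I. x i) + (\<Sum>i\<in>{..<N} - I. x i)"
      using x I sum.subset_diff[of I "{..<N}" x] by (auto simp: grid_layer_def)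
    also have "(\<Sum>i\<in>{..<N} - I. x i) = (\<Sum>i\<in>{..<N} - I. 2 * u)"
      using off[OF x] by (intro sum.cong) auto
    also have "(\<Sum>i\<in>I. x i) = (\<Sum>i\<in>I. x i mod u + (if u \<le> x i then u else 0))"
      using on[OF x] by (intro sum.cong) auto
    also have "\<dots> = (\<Sum>i\<in>I. x i mod u) + u * card {i \<in> I. u \<le> x i}"
      using fI by (simp add: sum.distrib sum.If_cases Int_def mult.commute)
    finally show ?thesis by simp
  qed
  have "inj_on g ?Y"
  proof (rule inj_onI)
    fix x y assume x: "x \<in> ?Y" and y: "y \<in> ?Y" and eq: "g x = g y"
    have "x i = y i" if "i < N" for i
    proof (cases "i \<in> I")
      case True
      have "restrict (\<lambda>i. x i mod u) I = restrict (\<lambda>i. y i mod u) I"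
        using eq by (simp add: g_def)
      then have "x i mod u = y i mod u" by (rule restrict_eqD) (rule True)
      moreover have "u \<le> x i \<longleftrightarrow> u \<le> y i" using eq True by (auto simp: g_def)
      ultimately show ?thesis using on[OF x True] on[OF y True] by simp
    next
      case False
      then show ?thesis using off[OF x] off[OF y] that by simp
    qed
    then show "x = y"
      using x y by (intro hypergrid_eqI[of x t N y]) (auto simp: grid_layer_def)
  qed
  moreover have "g ` ?Y \<subseteq> Sigma ?U (\<lambda>U. {B. B \<subseteq> I \<and> card B = e U})"
  proof
    fix p assume "p \<in> g ` ?Y"
    then obtain x where x: "x \<in> ?Y" "p = g x" by auto
    let ?R = "restrict (\<lambda>i. x i mod u) I"
    have R: "(\<Sum>i\<in>I. ?R i) = (\<Sum>i\<in>I. x i mod u)" by simp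
    have "s mod u = (\<Sum>i\<in>I. ?R i) mod u"
      unfolding R sum[OF x(1), symmetric] by (simp add: mult.assoc mult.left_commute[of 2])
    moreover have "card {i \<in> I. u \<le> x i} = e ?R"
      using sum[OF x(1)] u unfolding e_def R
      by (metis (no_types, lifting) add.commute add_diff_cancel_left' div_mult_self1_is_m add_diff_cancel_right' less_eq_Suc_le One_nat_def)
    ultimately show "p \<in> Sigma ?U (\<lambda>U. {B. B \<subseteq> I \<and> card B = e U})"
      using x(2) u by (auto simp: g_def)
  qed
  moreover have fU: "finite ?U" using fI by (simp add: finite_PiE)
  moreover have "finite (Sigma ?U (\<lambda>U. {B. B \<subseteq> I \<and> card B = e U}))"
    using fU fI by (intro finite_SigmaI) auto
  ultimately have "card ?Y \<le> card (Sigma ?U (\<lambda>U. {B. B \<subseteq> I \<and> card B = e U}))"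
    by (intro card_inj_on_le)
  also have "\<dots> = (\<Sum>U\<in>?U. card I choose e U)"
    using fU fI by (subst card_SigmaI) (auto simp: n_subsets)
  finally have "real (card ?Y) \<le> (\<Sum>U\<in>?U. real (card I choose e U))"
    by (simp flip: of_nat_sum)
  also have "\<dots> \<le> (\<Sum>U\<in>?U. 2 ^ card I / sqrt (real (card I + 1)))"
    by (intro sum_mono choose_le_central)
  also have "\<dots> = real (card ?U) * (2 ^ card I / sqrt (real (card I + 1)))" by simp
  also have "\<dots> \<le> real u ^ (card I - 1) * (2 ^ card I / sqrt (real (card I + 1)))"
    using card_PiE_sum_mod_le[OF fI I(2), of u "s mod u"]
    by (intro mult_right_mono) (auto simp flip: of_nat_power)
  finally show ?thesis .
qed

text \<open>Up to normalisation this is a mean over a binomial variable with success probability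
  \<open>z / (1 + z)\<close>. Cauchy-Schwarz passes from \<open>1 / sqrt (m + 1)\<close> to
  \<open>1 / (m + 1)\<close>, whose mean is computed by absorbing \<open>m + 1\<close> into the
  binomial coefficient.\<close>

lemma sum_binomial_div_sqrt_le:
  fixes z :: real
  assumes z: "1 \<le> z"
  shows "(\<Sum>m\<le>N. real (N choose m) * z ^ m / sqrt (real (m + 1))) \<le> (1 + z) ^ N * sqrt ((1 + z) / z) / sqrt (real (N + 1))"
proof -
  define w where "w m = real (N choose m) * z ^ m" for m
  have w: "w m \<ge> 0" for m using z by (simp add: w_def)
  have tot: "(\<Sum>m\<le>N. w m) = (1 + z) ^ N"
    using binomial_ring[of z 1 N] by (simp add: w_def add.commute)
  have "(\<Sum>m\<le>N. w m / real (m + 1)) = (\<Sum>m\<le>N. real (Suc N choose Suc m) * z ^ Suc m) / (z * real (N + 1))"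
    unfolding sum_divide_distrib
  proof (rule sum.cong[OF refl])
    fix m
    have "real (Suc m) * real (Suc N choose Suc m) = real (Suc N) * real (N choose m)"
      using Suc_times_binomial[of m N] by (metis of_nat_mult)
    then have eq: "real (N choose m) / real (m + 1) = real (Suc N choose Suc m) / real (N + 1)"
      by (simp add: frac_eq_eq mult.commute del: binomial_Suc_Suc)
    have "w m / real (m + 1) = real (N choose m) / real (m + 1) * z ^ m"
      by (simp add: w_def)
    also have "\<dots> = real (Suc N choose Suc m) * z ^ Suc m / (z * real (N + 1))"
      unfolding eq using z by (simp del: binomial_Suc_Suc)
    finally show "w m / real (m + 1) = real (Suc N choose Suc m) * z ^ Suc m / (z * real (N + 1))" .
  qed
  also have "(\<Sum>m\<le>N. real (Suc N choose Suc m) * z ^ Suc m) \<le> (\<Sum>m\<le>Suc N. real (Suc N choose m) * z ^ m)"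
    by (simp add: sum.atMost_Suc_shift[of _ N] del: sum.atMost_Suc binomial_Suc_Suc)
  also have "(\<Sum>m\<le>Suc N. real (Suc N choose m) * z ^ m) = (1 + z) ^ Suc N"
    using binomial_ring[of z 1 "Suc N"] by (simp add: add.commute del: binomial_Suc_Suc)
  finally have inv: "(\<Sum>m\<le>N. w m / real (m + 1)) \<le> (1 + z) ^ Suc N / (z * real (N + 1))"
    using z by (simp add: divide_right_mono)
  have "(\<Sum>m\<le>N. w m / sqrt (real (m + 1)))\<^sup>2 = (\<Sum>m\<le>N. sqrt (w m) * sqrt (w m / real (m + 1)))\<^sup>2"
    using w by (intro arg_cong[where f = "\<lambda>x. x\<^sup>2"] sum.cong) (auto simp: real_sqrt_divide)
  also have "\<dots> \<le> (\<Sum>m\<le>N. (sqrt (w m))\<^sup>2) * (\<Sum>m\<le>N. (sqrt (w m / real (m + 1)))\<^sup>2)"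
    by (rule Cauchy_Schwarz_ineq_sum)
  also have "\<dots> = (1 + z) ^ N * (\<Sum>m\<le>N. w m / real (m + 1))"
    using w by (simp add: tot)
  also have "\<dots> \<le> (1 + z) ^ N * ((1 + z) ^ Suc N / (z * real (N + 1)))"
    using inv z by (intro mult_left_mono) auto
  also have "\<dots> = ((1 + z) ^ N * sqrt ((1 + z) / z) / sqrt (real (N + 1)))\<^sup>2"
  proof -
    have "(sqrt ((1 + z) / z))\<^sup>2 = (1 + z) / z" "(sqrt (real (N + 1)))\<^sup>2 = real (N + 1)"
      using z by auto
    then show ?thesis
      unfolding power_divide power_mult_distrib by (simp only:) (simp add: power2_eq_square)
  qed
  finally show ?thesis
    unfolding w_def by (rule power2_le_imp_le) (use z in simp)
qed

lemma sum_Pow_card: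
  fixes f :: "nat \<Rightarrow> real"
  assumes "finite S"
  shows "(\<Sum>I\<in>Pow S. f (card I)) = (\<Sum>m\<le>card S. real (card S choose m) * f m)"
proof -
  have "(\<Sum>I\<in>Pow S. f (card I)) = (\<Sum>m\<le>card S. \<Sum>I\<in>{I \<in> Pow S. card I = m}. f (card I))"
    using assms by (intro sum.group[symmetric]) (auto intro: card_mono)
  also have "\<dots> = (\<Sum>m\<le>card S. \<Sum>I\<in>{I \<in> Pow S. card I = m}. f m)"
    by (intro sum.cong) auto
  also have "\<dots> = (\<Sum>m\<le>card S. real (card S choose m) * f m)"
    using n_subsets[OF assms] by (simp add: Pow_def)
  finally show ?thesis .
qed

text \<open>For even \<open>t\<close> a single pattern occurs. For odd \<open>t\<close> the pattern
  bounds carry the weights \<open>(2 * u) ^ card I\<close>; since \<open>1 + 2 * u = t\<close>,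
  their binomial sum restores \<open>t ^ N\<close>, and the division by \<open>u\<close> saves one
  factor of order \<open>t\<close>.\<close>

lemma card_grid_layer_le:
  assumes t: "2 \<le> t" and N: "1 \<le> N"
  shows "real (card (grid_layer t N s)) \<le> 5 * real t ^ (N - 1) / sqrt (real N)"
proof -
  define u where "u = t div 2"
  have u: "1 \<le> u" "t \<le> 2 * u + 1" "2 * u \<le> t" using t by (auto simp: u_def)
  let ?Y = "\<lambda>I. {x \<in> grid_layer t N s. {i. i < N \<and> x i < 2 * u} = I}"
  have sq: "1 / sqrt (real (N + 1)) \<le> 1 / sqrt (real N)" using N by (simp add: frac_le)
  show ?thesis
  proof (cases "t = 2 * u")
    case True
    have "grid_layer t N s = ?Y {..<N}"
      using hypergrid_less True by (auto simp: grid_layer_def)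
    then have "real (card (grid_layer t N s)) \<le> real u ^ (N - 1) * (2 ^ N / sqrt (real (N + 1)))"
      using card_grid_layer_pattern_le[OF u(1,2), of "{..<N}" N s] N by (simp add: lessThan_empty_iff)
    also have "\<dots> = 2 * real t ^ (N - 1) * (1 / sqrt (real (N + 1)))"
      using N True by (cases N) (auto simp: power_mult_distrib)
    also have "\<dots> \<le> 2 * real t ^ (N - 1) * (1 / sqrt (real N))"
      using sq by (intro mult_left_mono) auto
    also have "\<dots> \<le> 5 * real t ^ (N - 1) / sqrt (real N)" by (simp add: divide_right_mono)
    finally show ?thesis .
  next
    case False
    then have tu: "real t = 1 + 2 * real u" using u by auto
    \<comment> \<open>The pattern bound requires a nonempty \<open>I\<close>. The empty pattern
      admits only the point with all coordinates \<open>2 * u\<close>, whence the extra 1.\<close>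
    have "real (card (?Y I)) \<le> (if I = {} then 1 else 0) +
        (2 * real u) ^ card I / sqrt (real (card I + 1)) / real u" if I: "I \<in> Pow {..<N}" for I
    proof (cases "I = {}")
      case True
      have "x = (\<lambda>i. if i < N then 2 * u else undefined)" if "x \<in> ?Y {}" for x
      proof
        fix i
        show "x i = (if i < N then 2 * u else undefined)"
        proof (cases "i < N")
          case True
          then have "x i < t" "\<not> x i < 2 * u" using that by (auto simp: grid_layer_def hypergrid_less)
          then show ?thesis using True u by simp
        next
          case False
          then show ?thesis using that by (auto simp: grid_layer_def hypergrid_def PiE_iff extensional_def)
        qed
      qed
      then have "?Y {} \<subseteq> {\<lambda>i. if i < N then 2 * u else undefined}" by blast
      then have "card (?Y {}) \<le> card {\<lambda>i. if i < N then 2 * u else (undefined::nat)}"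
        by (intro card_mono) auto
      then have "real (card (?Y {})) \<le> 1" by simp
      then show ?thesis unfolding True by (simp add: add_increasing2)
    next
      case False
      have "finite I" using I finite_subset by auto
      then obtain m where m: "card I = Suc m" using False by (metis card_eq_0_iff not0_implies_Suc)
      show ?thesis
        using card_grid_layer_pattern_le[OF u(1,2) _ False, of N s] I False u(1)
        by (simp add: m power_mult_distrib mult_ac)
    qed
    note pattern = this
    have "grid_layer t N s = (\<Union>I\<in>Pow {..<N}. ?Y I)"
    proof (intro equalityI subsetI)
      fix x assume "x \<in> grid_layer t N s"
      then show "x \<in> (\<Union>I\<in>Pow {..<N}. ?Y I)"
        by (intro UN_I[of "{i. i < N \<and> x i < 2 * u}"]) auto
    qed blast
    then have "real (card (grid_layer t N s)) \<le> (\<Sum>I\<in>Pow {..<N}. real (card (?Y I)))"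
      using card_UN_le[of "Pow {..<N}" ?Y] by (simp flip: of_nat_sum)
    also have "\<dots> \<le> (\<Sum>I\<in>Pow {..<N}. (if I = {} then 1 else 0) +
        (2 * real u) ^ card I / sqrt (real (card I + 1)) / real u)"
      using pattern by (rule sum_mono)
    also have "\<dots> = 1 + (\<Sum>I\<in>Pow {..<N}. (2 * real u) ^ card I / sqrt (real (card I + 1))) / real u"
      by (simp add: sum.distrib sum_divide_distrib)
    also have "(\<Sum>I\<in>Pow {..<N}. (2 * real u) ^ card I / sqrt (real (card I + 1))) =
        (\<Sum>m\<le>N. real (N choose m) * (2 * real u) ^ m / sqrt (real (m + 1)))"
      using sum_Pow_card[of "{..<N}" "\<lambda>m. (2 * real u) ^ m / sqrt (real (m + 1))"] by simp
    also have "1 + \<dots> / real u \<le> 1 + (real t ^ N * sqrt (real t / (2 * real u)) / sqrt (real (N + 1))) / real u"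
      using sum_binomial_div_sqrt_le[of "2 * real u" N] u(1) unfolding tu
      by (intro add_left_mono divide_right_mono) auto
    \<comment> \<open>From \<open>u \<ge> 1\<close>: \<open>t / u\<close> is at most 3 and the
      square root at most 4/3, with product 4.\<close>
    also have "\<dots> \<le> 1 + 4 * real t ^ (N - 1) * (1 / sqrt (real (N + 1)))"
    proof -
      have r: "real t / (2 * real u) \<le> 3 / 2" "real t / real u \<le> 3"
        using u(1) tu by (auto simp: field_simps)
      have "sqrt (real t / (2 * real u)) \<le> 4 / 3"
        using r(1) by (intro real_le_lsqrt) (auto simp: power2_eq_square)
      then have "real t / real u * sqrt (real t / (2 * real u)) \<le> 3 * (4 / 3)"
        using r(2) by (intro mult_mono) auto
      moreover have "real t ^ N = real t * real t ^ (N - 1)" using N by (cases N) auto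
      ultimately show ?thesis
        using mult_right_mono[of "real t / real u * sqrt (real t / (2 * real u))" 4 "real t ^ (N - 1) / sqrt (real (N + 1))"]
        by (simp add: field_simps)
    qed
    also have "\<dots> \<le> 1 + 4 * real t ^ (N - 1) * (1 / sqrt (real N))"
      using sq by (intro add_left_mono mult_left_mono) auto
    finally have "real (card (grid_layer t N s)) \<le> 1 + 4 * real t ^ (N - 1) * (1 / sqrt (real N))" .
    \<comment> \<open>This absorbs the summand 1 of the empty pattern and turns the constant 4 into
      5.\<close>
    moreover have "1 \<le> real t ^ (N - 1) / sqrt (real N)"
    proof -
      have "N \<le> 2 ^ (N - 1)" using N less_exp[of "N - 1"] by linarith
      then have "real N \<le> real (2 ^ (N - 1))" unfolding of_nat_le_iff .
      then have "real N \<le> 2 ^ (N - 1)" by simp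
      moreover have "sqrt (real N) \<le> real N" using N by (intro real_le_lsqrt) (auto simp: power2_eq_square)
      moreover have "(2::real) ^ (N - 1) \<le> real t ^ (N - 1)" using t by (intro power_mono) auto
      ultimately have "sqrt (real N) \<le> real t ^ (N - 1)" by linarith
      then show ?thesis using N by (simp add: field_simps)
    qed
    ultimately show ?thesis by simp
  qed
qed

section \<open>A lower bound for the width\<close>

lemma sum_hypergrid_Suc:
  fixes f :: "(nat \<Rightarrow> nat) \<Rightarrow> real"
  shows "(\<Sum>x\<in>hypergrid t (Suc n). f x) = (\<Sum>x\<in>hypergrid t n. \<Sum>v<t. f (x(n := v)))"
proof -
  have "(\<Sum>x\<in>hypergrid t n. \<Sum>v<t. f (x(n := v))) = (\<Sum>p\<in>hypergrid t n \<times> {..<t}. f ((fst p)(n := snd p)))"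
    by (simp add: sum.cartesian_product case_prod_beta)
  also have "\<dots> = (\<Sum>x\<in>hypergrid t (Suc n). f x)"
  proof (rule sum.reindex_bij_witness[of _ "\<lambda>x. (restrict x {..<n}, x n)" "\<lambda>p. (fst p)(n := snd p)"])
    fix p assume p: "p \<in> hypergrid t n \<times> {..<t}"
    have "restrict ((fst p)(n := snd p)) {..<n} i = fst p i" for i
      using p PiE_arb[of "fst p" "{..<n}" "\<lambda>_. {..<t}" i] by (simp add: hypergrid_def mem_Times_iff)
    then have "restrict ((fst p)(n := snd p)) {..<n} = fst p" by (rule ext)
    then show "(restrict ((fst p)(n := snd p)) {..<n}, ((fst p)(n := snd p)) n) = p" by simp
    show "(fst p)(n := snd p) \<in> hypergrid t (Suc n)"
      using p by (cases p) (simp add: hypergrid_def lessThan_Suc PiE_fun_upd)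
  next
    fix x assume x: "x \<in> hypergrid t (Suc n)"
    have "((restrict x {..<n})(n := x n)) i = x i" for i
      using x PiE_arb[of x "{..<Suc n}" "\<lambda>_. {..<t}" i] by (simp add: hypergrid_def)
    then have "(restrict x {..<n})(n := x n) = x" by (rule ext)
    then show "(fst (restrict x {..<n}, x n))(n := snd (restrict x {..<n}, x n)) = x" by simp
    show "(restrict x {..<n}, x n) \<in> hypergrid t n \<times> {..<t}"
      using x by (auto simp: hypergrid_def PiE_iff)
  qed simp
  finally show ?thesis by simp
qed

lemma card_hypergrid: "card (hypergrid t n) = t ^ n"
  by (simp add: hypergrid_def card_PiE)

text \<open>A variance bound for the rank of a uniform point; doubling the rank avoids halves in its
  mean. Each centred coordinate sums to zero, so cross terms vanish, and it contributes at most
  \<open>t * t\<close> on average.\<close>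

lemma sum_centred_rank_squared_le:
  "(\<Sum>x\<in>hypergrid t n. (2 * real (\<Sum>i<n. x i) - real n * (real t - 1))\<^sup>2) \<le> real n * real t ^ (n + 2)"
proof (induction n)
  case 0
  then show ?case by (simp add: hypergrid_def)
next
  case (Suc n)
  define a where "a x = 2 * real (\<Sum>i<n. x i) - real n * (real t - 1)" for x
  define c where "c v = 2 * real v - (real t - 1)" for v
  have c0: "(\<Sum>v<t. c v) = 0"
  proof -
    have "(\<Sum>v<t. 2 * real v) = real t * (real t - 1)" by (induction t) (auto simp: algebra_simps)
    then show ?thesis by (simp add: c_def sum_subtractf)
  qed
  have c2: "(\<Sum>v<t. (c v)\<^sup>2) \<le> (\<Sum>v<t. (real t)\<^sup>2)"
  proof (rule sum_mono)
    fix v assume "v \<in> {..<t}"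
    then have "\<bar>c v\<bar> \<le> \<bar>real t\<bar>" by (auto simp: c_def abs_le_iff)
    then show "(c v)\<^sup>2 \<le> (real t)\<^sup>2" by (simp only: abs_le_square_iff)
  qed
  have "(\<Sum>x\<in>hypergrid t (Suc n). (2 * real (\<Sum>i<Suc n. x i) - real (Suc n) * (real t - 1))\<^sup>2)
      = (\<Sum>x\<in>hypergrid t n. \<Sum>v<t. (a x + c v)\<^sup>2)"
    unfolding sum_hypergrid_Suc by (intro sum.cong) (auto simp: a_def c_def algebra_simps)
  also have "\<dots> = (\<Sum>x\<in>hypergrid t n. real t * (a x)\<^sup>2 + 2 * a x * (\<Sum>v<t. c v) + (\<Sum>v<t. (c v)\<^sup>2))"
    by (intro sum.cong) (auto simp: power2_sum sum.distrib sum_distrib_left mult_ac)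
  also have "\<dots> = real t * (\<Sum>x\<in>hypergrid t n. (a x)\<^sup>2) + real t ^ n * (\<Sum>v<t. (c v)\<^sup>2)"
    by (simp add: c0 sum.distrib sum_distrib_left card_hypergrid)
  also have "\<dots> \<le> real t * (real n * real t ^ (n + 2)) + real t ^ n * (\<Sum>v<t. (real t)\<^sup>2)"
    using Suc c2 unfolding a_def by (intro add_mono mult_left_mono) auto
  also have "\<dots> = real (Suc n) * real t ^ (Suc n + 2)" by (simp add: algebra_simps power2_eq_square)
  finally show ?case .
qed

lemma grid_layer_antichain: "grid_layer t n s \<in> grid_antichains t n"
proof -
  have "x = y" if "x \<in> grid_layer t n s" "y \<in> grid_layer t n s" "grid_le n x y" for x y
  proof -
    have "x i = y i" if "i < n" for i
    proof (rule ccontr)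
      assume "x i \<noteq> y i"
      then have "(\<Sum>i<n. x i) < (\<Sum>i<n. y i)"
        using \<open>grid_le n x y\<close> that by (intro sum_strict_mono_ex1) (auto simp: grid_le_def le_less)
      then show False using \<open>x \<in> _\<close> \<open>y \<in> _\<close> by (simp add: grid_layer_def)
    qed
    then show ?thesis
      using \<open>x \<in> _\<close> \<open>y \<in> _\<close> by (intro hypergrid_eqI[of x t n y]) (auto simp: grid_layer_def)
  qed
  then show ?thesis by (auto simp: grid_antichains_def grid_layer_def)
qed

text \<open>By Chebyshev, half of the grid lies in the \<open>O(t\<surd>n)\<close> layers around the middle.\<close>

lemma grid_width_ge:
  assumes n: "1 \<le> n" and t: "1 \<le> t"
  shows "real t ^ (n - 1) / (8 * sqrt (real n)) \<le> real (grid_width t n)"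
proof -
  let ?w = "real (grid_width t n)"
  define a where "a x = 2 * real (\<Sum>i<n. x i) - real n * (real t - 1)" for x
  \<comment> \<open>\<open>L\<^sup>2\<close> is twice the bound on the mean of
    \<open>(a x)\<^sup>2\<close>, so Chebyshev leaves at most half of the grid in
    \<open>far\<close>.\<close>
  define L where "L = real t * sqrt (2 * real n)"
  have L: "L > 0" "L\<^sup>2 = 2 * real n * (real t)\<^sup>2" using n t by (auto simp: L_def power_mult_distrib)
  have L1: "L \<ge> 1"
  proof -
    have "1 \<le> sqrt (2 * real n)" using n by simp
    then show ?thesis using t unfolding L_def using mult_mono[of 1 "real t" 1 "sqrt (2 * real n)"] by simp
  qed
  define far where "far = {x \<in> hypergrid t n. \<bar>a x\<bar> > L}"
  define near where "near = {x \<in> hypergrid t n. \<bar>a x\<bar> \<le> L}"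
  have "real (card far) * L\<^sup>2 = (\<Sum>x\<in>far. L\<^sup>2)" by simp
  also have "\<dots> \<le> (\<Sum>x\<in>far. (a x)\<^sup>2)"
  proof (rule sum_mono)
    fix x assume "x \<in> far"
    then have "\<bar>L\<bar> \<le> \<bar>a x\<bar>" using L(1) by (auto simp: far_def)
    then show "L\<^sup>2 \<le> (a x)\<^sup>2" by (simp only: abs_le_square_iff)
  qed
  also have "\<dots> \<le> (\<Sum>x\<in>hypergrid t n. (a x)\<^sup>2)"
    by (intro sum_mono2) (auto simp: far_def finite_hypergrid)
  also have "\<dots> \<le> real n * real t ^ (n + 2)"
    using sum_centred_rank_squared_le unfolding a_def .
  finally have "real (card far) * L\<^sup>2 \<le> (real t ^ n / 2) * L\<^sup>2"
    unfolding L(2) by (simp add: power_add power2_eq_square algebra_simps)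
  then have far: "real (card far) \<le> real t ^ n / 2"
    using L(1) by (subst (asm) mult_le_cancel_right) auto
  have "card far + card near = t ^ n"
    unfolding card_hypergrid[symmetric]
    by (subst card_Un_disjoint[symmetric]) (auto simp: far_def near_def finite_hypergrid intro!: arg_cong[where f = card])
  then have near: "real t ^ n / 2 \<le> real (card near)"
    using far by (simp flip: of_nat_power of_nat_add) 
  \<comment> \<open>As \<open>a\<close> is twice the centred rank, points of \<open>near\<close>
    have ranks in an interval of length \<open>L\<close>, which contains at most
    \<open>L + 1 \<le> 2 * L\<close> integers.\<close>
  define lo where "lo = (real n * (real t - 1) - L) / 2"
  define S where "S = {s::nat. lo \<le> real s \<and> real s \<le> lo + L}"
  have sub: "int ` S \<subseteq> {\<lceil>lo\<rceil>..\<lfloor>lo + L\<rfloor>}" by (auto simp: S_def ceiling_le_iff le_floor_iff)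
  then have "finite (int ` S)" "card (int ` S) \<le> card {\<lceil>lo\<rceil>..\<lfloor>lo + L\<rfloor>}"
    using finite_subset[OF sub] card_mono[OF _ sub] by simp_all
  then have cS: "finite S" "card S \<le> nat (\<lfloor>lo + L\<rfloor> - \<lceil>lo\<rceil> + 1)"
    by (auto simp: card_image dest: finite_imageD)
  have "real (nat (\<lfloor>lo + L\<rfloor> - \<lceil>lo\<rceil> + 1)) \<le> L + 1"
    using L(1) by linarith
  then have S: "real (card S) \<le> 2 * L" using cS(2) L1 by linarith
  have "near \<subseteq> (\<Union>s\<in>S. grid_layer t n s)"
    by (auto simp: near_def S_def grid_layer_def a_def lo_def abs_le_iff field_simps simp del: of_nat_sum)
  then have "card near \<le> card (\<Union>s\<in>S. grid_layer t n s)"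
    using cS(1) finite_grid_layer by (intro card_mono) auto
  also have "\<dots> \<le> (\<Sum>s\<in>S. card (grid_layer t n s))" by (rule card_UN_le[OF cS(1)])
  also have "\<dots> \<le> (\<Sum>s\<in>S. grid_width t n)"
    by (intro sum_mono card_le_grid_width grid_layer_antichain)
  finally have "real (card near) \<le> real (card S) * ?w" by (simp flip: of_nat_mult)
  also have "\<dots> \<le> 2 * L * ?w" using S by (intro mult_right_mono) auto
  finally have "real t ^ n / 2 \<le> 2 * L * ?w" using near by linarith
  also have "\<dots> \<le> 2 * (real t * (2 * sqrt (real n))) * ?w"
  proof -
    have "sqrt 2 \<le> (2::real)" by (rule real_le_lsqrt) auto
    then show ?thesis
      unfolding L_def real_sqrt_mult by (intro mult_right_mono mult_left_mono) auto
  qed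
  finally have "real t * real t ^ (n - 1) \<le> real t * (8 * sqrt (real n) * ?w)"
    using n by (cases n) (auto simp: algebra_simps)
  then have "real t ^ (n - 1) \<le> 8 * sqrt (real n) * ?w" using t by simp
  then show ?thesis using n by (simp add: field_simps)
qed

section \<open>Independent sets in graphs of large degree\<close>

definition indep_sets :: "('a \<Rightarrow> 'a \<Rightarrow> bool) \<Rightarrow> 'a set \<Rightarrow> 'a set set" where
  "indep_sets R F = {A. A \<subseteq> F \<and> (\<forall>x\<in>A. \<forall>y\<in>A. x \<noteq> y \<longrightarrow> \<not> R x y)}"

text \<open>The independence polynomial at \<open>\<mu>\<close>, or hard-core partition function
  with fugacity \<open>\<mu>\<close>.\<close>

definition indep_gf :: "('a \<Rightarrow> 'a \<Rightarrow> bool) \<Rightarrow> real \<Rightarrow> 'a set \<Rightarrow> real" where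
  "indep_gf R \<mu> F = (\<Sum>A\<in>indep_sets R F. \<mu> ^ card A)"

lemma finite_indep_sets: "finite F \<Longrightarrow> finite (indep_sets R F)"
  by (rule finite_subset[of _ "Pow F"]) (auto simp: indep_sets_def)

text \<open>Sets avoiding \<open>x\<close> give the first term. A set containing \<open>x\<close>
  loses it at the cost of a factor \<open>\<mu>\<close>, and what remains avoids the neighbours of
  \<open>x\<close>.\<close>

lemma indep_gf_remove:
  assumes "finite F" "x \<in> F" "0 \<le> \<mu>"
  shows "indep_gf R \<mu> F \<le> indep_gf R \<mu> (F - {x}) + \<mu> * indep_gf R \<mu> {y \<in> F - {x}. \<not> R x y}"
proof -
  let ?P = "{A \<in> indep_sets R F. x \<notin> A}" and ?Q = "{A \<in> indep_sets R F. x \<in> A}"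
  let ?G = "{y \<in> F - {x}. \<not> R x y}"
  have fin: "finite (indep_sets R F)" using assms finite_indep_sets by blast
  have "indep_gf R \<mu> F = (\<Sum>A\<in>?P. \<mu> ^ card A) + (\<Sum>A\<in>?Q. \<mu> ^ card A)"
    unfolding indep_gf_def by (subst sum.union_disjoint[symmetric]) (auto simp: fin intro!: sum.cong)
  also have "?P = indep_sets R (F - {x})" by (auto simp: indep_sets_def)
  also have "(\<Sum>A\<in>?Q. \<mu> ^ card A) = (\<Sum>A\<in>(\<lambda>A. A - {x}) ` ?Q. \<mu> * \<mu> ^ card A)"
  proof (subst sum.reindex)
    show "inj_on (\<lambda>A. A - {x}) ?Q" by (auto intro!: inj_onI)
    show "(\<Sum>A\<in>?Q. \<mu> ^ card A) = sum ((\<lambda>A. \<mu> * \<mu> ^ card A) \<circ> (\<lambda>A. A - {x})) ?Q"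
    proof (rule sum.cong[OF refl])
      fix A assume "A \<in> ?Q"
      then have "finite A" "x \<in> A" using assms(1) by (auto simp: indep_sets_def intro: finite_subset)
      then have "card A = Suc (card (A - {x}))" by (rule card.remove)
      then show "\<mu> ^ card A = ((\<lambda>A. \<mu> * \<mu> ^ card A) \<circ> (\<lambda>A. A - {x})) A"
        by (simp only: comp_apply power_Suc)
    qed
  qed
  also have "\<dots> \<le> (\<Sum>A\<in>indep_sets R ?G. \<mu> * \<mu> ^ card A)"
    using assms by (intro sum_mono2 finite_indep_sets) (auto simp: indep_sets_def)
  finally show ?thesis by (simp add: indep_gf_def sum_distrib_left)
qed

text \<open>Independent sets containing a vertex of degree \<open>d\<close> avoid \<open>d\<close> further vertices;
  this replaces the container algorithm by a one-line recursion for the generating function.\<close>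

lemma indep_gf_le_exp:
  fixes \<delta> :: "nat \<Rightarrow> real"
  assumes "finite F" "0 \<le> \<mu>"
    and anti: "\<And>u v. 1 \<le> u \<Longrightarrow> u \<le> v \<Longrightarrow> \<delta> v \<le> \<delta> u" and nonneg: "\<And>u. 0 \<le> \<delta> u"
    and deg: "\<And>G. G \<subseteq> F \<Longrightarrow> G \<noteq> {} \<Longrightarrow> \<mu> \<le> \<delta> (card G) \<or>
      (\<exists>x\<in>G. \<mu> * exp (- real (card {y \<in> G. y \<noteq> x \<and> R x y}) * \<delta> (card G)) \<le> \<delta> (card G))"
  shows "indep_gf R \<mu> F \<le> exp (\<Sum>u=1..card F. \<delta> u)"
  using assms(1) deg
proof (induction F rule: finite_psubset_induct)
  case (psubset F)
  define h where "h v = (\<Sum>u=1..v. \<delta> u)" for v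
  have IH: "indep_gf R \<mu> G \<le> exp (h (card G))" if "G \<subset> F" for G
    unfolding h_def using that psubset.prems by (intro psubset.IH) auto
  show ?case
  proof (cases "F = {}")
    case True
    then have "indep_sets R F = {{}}" by (auto simp: indep_sets_def)
    then show ?thesis using True by (simp add: indep_gf_def)
  next
    case False
    let ?v = "card F"
    have v: "?v \<ge> 1" using False psubset.hyps by (simp add: Suc_le_eq card_gt_0_iff)
    have hv: "h ?v = h (?v - 1) + \<delta> ?v"
      using v by (cases ?v) (auto simp: h_def)
    \<comment> \<open>Both alternatives of the degree hypothesis lead here: if
      \<open>\<mu> \<le> \<delta> ?v\<close>, any vertex works because the exponential is at most
      1.\<close>
    have "\<exists>x\<in>F. \<mu> * exp (- real (card {y \<in> F. y \<noteq> x \<and> R x y}) * \<delta> ?v) \<le> \<delta> ?v"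
    proof (cases "\<mu> \<le> \<delta> ?v")
      case True
      obtain x where "x \<in> F" using False by auto
      moreover have "\<mu> * exp (- real (card {y \<in> F. y \<noteq> x \<and> R x y}) * \<delta> ?v) \<le> \<mu> * 1"
        using assms(2) nonneg by (intro mult_left_mono) auto
      ultimately show ?thesis using True by force
    next
      case False
      then show ?thesis using psubset.prems[of F] \<open>F \<noteq> {}\<close> by blast
    qed
    then obtain x where x: "x \<in> F" "\<mu> * exp (- real (card {y \<in> F. y \<noteq> x \<and> R x y}) * \<delta> ?v) \<le> \<delta> ?v"
      by blast
    define N where "N = {y \<in> F. y \<noteq> x \<and> R x y}"
    define G where "G = {y \<in> F - {x}. \<not> R x y}"
    have "F - {x} = G \<union> N" "G \<inter> N = {}" by (auto simp: G_def N_def)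
    then have "card (F - {x}) = card G + card N"
      using psubset.hyps by (metis card_Un_disjoint finite_Diff finite_Un)
    then have cards: "card G + card N = ?v - 1" using x(1) by simp
    have "h (card G) + (\<Sum>u=card G + 1..?v - 1. \<delta> u) = h (?v - 1)"
      unfolding h_def using cards
      by (subst sum.union_disjoint[symmetric]) (auto intro!: sum.cong)
    \<comment> \<open>By monotonicity each of the \<open>card N\<close> neighbours lost with
      \<open>x\<close> lowers the exponent by at least \<open>\<delta> ?v\<close>.\<close>
    moreover have "(\<Sum>u=card G + 1..?v - 1. \<delta> u) \<ge> (\<Sum>u=card G + 1..?v - 1. \<delta> ?v)"
      using anti by (intro sum_mono) auto
    moreover have "card {card G + 1..?v - 1} = card N" using cards by simp
    ultimately have hG: "h (card G) \<le> h (?v - 1) - real (card N) * \<delta> ?v" by simp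
    have "indep_gf R \<mu> F \<le> indep_gf R \<mu> (F - {x}) + \<mu> * indep_gf R \<mu> G"
      unfolding G_def using psubset.hyps x(1) assms(2) by (rule indep_gf_remove)
    also have "\<dots> \<le> exp (h (?v - 1)) + \<mu> * exp (h (card G))"
      using IH[of "F - {x}"] IH[of G] x(1) psubset.hyps assms(2)
      by (intro add_mono mult_left_mono) (auto simp: G_def)
    also have "\<dots> \<le> exp (h (?v - 1)) + \<mu> * exp (h (?v - 1) - real (card N) * \<delta> ?v)"
      using hG assms(2) by (intro add_left_mono mult_left_mono) auto
    also have "\<dots> = exp (h (?v - 1)) * (1 + \<mu> * exp (- real (card N) * \<delta> ?v))"
      by (simp add: exp_diff exp_minus field_simps)
    also have "1 + \<mu> * exp (- real (card N) * \<delta> ?v) \<le> 1 + \<delta> ?v"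
      using x(2) unfolding N_def by (rule add_left_mono)
    also have "1 + \<delta> ?v \<le> exp (\<delta> ?v)" by (rule exp_ge_add_one_self)
    finally show ?thesis using hv unfolding h_def by (simp add: exp_add)
  qed
qed

text \<open>Markov's inequality in the form of Rankin's trick: as \<open>\<mu> \<le> 1\<close>, a
  set of size at most \<open>s\<close> has weight at least \<open>\<mu> powr s\<close>.\<close>

lemma card_small_indep_sets_le:
  assumes "finite F" "0 < \<mu>" "\<mu> \<le> 1" and s: "0 \<le> s"
  shows "real (card {A \<in> indep_sets R F. real (card A) \<le> s}) \<le> \<mu> powr (- s) * indep_gf R \<mu> F"
proof -
  have "real (card {A \<in> indep_sets R F. real (card A) \<le> s}) =
      (\<Sum>A\<in>{A \<in> indep_sets R F. real (card A) \<le> s}. 1)" by simp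
  also have "\<dots> \<le> (\<Sum>A\<in>{A \<in> indep_sets R F. real (card A) \<le> s}. \<mu> powr (- s) * \<mu> ^ card A)"
  proof (rule sum_mono)
    fix A assume "A \<in> {A \<in> indep_sets R F. real (card A) \<le> s}"
    then have "\<mu> powr s \<le> \<mu> powr real (card A)" using assms by (intro powr_mono') auto
    then show "1 \<le> \<mu> powr (- s) * \<mu> ^ card A"
      using assms by (simp add: powr_minus powr_realpow field_simps)
  qed
  also have "\<dots> \<le> (\<Sum>A\<in>indep_sets R F. \<mu> powr (- s) * \<mu> ^ card A)"
    using assms by (intro sum_mono2 finite_indep_sets) auto
  finally show ?thesis by (simp add: indep_gf_def sum_distrib_left)
qed

text \<open>Averaging over \<open>M\<close> colourings: a pair that is close (\<open>\<not> far\<close>) is discarded, and a far pair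
  is monochromatic in at most one colouring, so monochromatic far pairs are never counted twice.\<close>

lemma exists_high_degree_of_colourings:
  fixes key :: "nat \<Rightarrow> 'a \<Rightarrow> 'b" and X q :: real
  assumes F: "finite F" "F \<noteq> {}" and X: "0 < X"
    and keys: "\<And>b. b < M \<Longrightarrow> real (card (key b ` F)) \<le> X"
    and near: "\<And>b x. b < M \<Longrightarrow> x \<in> F \<Longrightarrow> real (card {y \<in> F. key b y = key b x \<and> \<not> far x y}) \<le> q"
    and comp: "\<And>b x y. b < M \<Longrightarrow> x \<in> F \<Longrightarrow> y \<in> F \<Longrightarrow> far x y \<Longrightarrow> key b y = key b x \<Longrightarrow> y \<noteq> x \<and> R x y"
    and once: "\<And>b c x y. b < M \<Longrightarrow> c < M \<Longrightarrow> x \<in> F \<Longrightarrow> y \<in> F \<Longrightarrow> far x y \<Longrightarrow>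
      key b y = key b x \<Longrightarrow> key c y = key c x \<Longrightarrow> b = c"
  shows "\<exists>x\<in>F. real M * (real (card F) / X - q) \<le> real (card {y \<in> F. y \<noteq> x \<and> R x y})"
proof -
  define D where "D x = real (card {y \<in> F. y \<noteq> x \<and> R x y})" for x
  define m where "m b x = {y \<in> F. key b y = key b x \<and> far x y}" for b x
  \<comment> \<open>Cauchy-Schwarz over the colour classes: with at most \<open>X\<close> classes,
    monochromatic ordered pairs are fewest when the classes have equal size.\<close>
  have cls: "(\<Sum>x\<in>F. real (card {y \<in> F. key b y = key b x})) \<ge> (real (card F))\<^sup>2 / X" if "b < M" for b
  proof -
    let ?K = "key b ` F"
    define c where "c k = real (card {y \<in> F. key b y = k})" for k
    have fin: "finite ?K" using F by simp
    have tot: "(\<Sum>k\<in>?K. c k) = real (card F)"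
      unfolding c_def using sum.image_gen[OF F(1), of "\<lambda>_. 1::real" "key b"] by simp
    have "(\<Sum>x\<in>F. c (key b x)) = (\<Sum>k\<in>?K. \<Sum>x\<in>{x \<in> F. key b x = k}. c (key b x))"
      by (rule sum.image_gen[OF F(1)])
    also have "\<dots> = (\<Sum>k\<in>?K. (c k)\<^sup>2)"
      by (intro sum.cong) (auto simp: c_def power2_eq_square)
    finally have sq: "(\<Sum>x\<in>F. c (key b x)) = (\<Sum>k\<in>?K. (c k)\<^sup>2)" .
    have "(real (card F))\<^sup>2 \<le> (\<Sum>k\<in>?K. (c k)\<^sup>2) * real (card ?K)"
      using sum_squared_le_sum_of_squares[of c ?K] tot by (simp add: mult.commute)
    also have "\<dots> \<le> (\<Sum>k\<in>?K. (c k)\<^sup>2) * X"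
      using keys[OF that] by (intro mult_left_mono sum_nonneg) auto
    finally show ?thesis using X sq by (simp add: c_def field_simps)
  qed
  have step: "(\<Sum>x\<in>F. real (card (m b x))) \<ge> real (card F) * (real (card F) / X - q)" if b: "b < M" for b
  proof -
    have "real (card {y \<in> F. key b y = key b x}) \<le> real (card (m b x)) + q" if "x \<in> F" for x
    proof -
      have "{y \<in> F. key b y = key b x} = m b x \<union> {y \<in> F. key b y = key b x \<and> \<not> far x y}"
        by (auto simp: m_def)
      then have "card {y \<in> F. key b y = key b x} \<le>
          card (m b x) + card {y \<in> F. key b y = key b x \<and> \<not> far x y}"
        by (simp add: card_Un_le)
      then show ?thesis using near[OF b that] by linarith
    qed
    then have "(\<Sum>x\<in>F. real (card {y \<in> F. key b y = key b x})) \<le> (\<Sum>x\<in>F. real (card (m b x)) + q)"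
      by (intro sum_mono)
    then show ?thesis using cls[OF b]
      by (simp add: sum.distrib algebra_simps power2_eq_square)
  qed
  have "real (card F) * (real M * (real (card F) / X - q)) \<le> (\<Sum>b<M. \<Sum>x\<in>F. real (card (m b x)))"
    using sum_mono[of "{..<M}" "\<lambda>_. real (card F) * (real (card F) / X - q)", OF step]
    by (simp add: mult.left_commute)
  also have "\<dots> = (\<Sum>x\<in>F. \<Sum>b<M. real (card (m b x)))" by (rule sum.swap)
  also have "\<dots> \<le> (\<Sum>x\<in>F. D x)"
  proof (rule sum_mono)
    fix x assume x: "x \<in> F"
    have "(\<Sum>b<M. card (m b x)) = card (\<Union>b<M. m b x)"
      using F once x by (intro card_UN_disjoint[symmetric]) (auto simp: m_def)
    also have "\<dots> \<le> card {y \<in> F. y \<noteq> x \<and> R x y}"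
      using F comp x by (intro card_mono) (auto simp: m_def)
    finally show "(\<Sum>b<M. real (card (m b x))) \<le> D x" unfolding D_def by (simp flip: of_nat_sum)
  qed
  finally have *: "real (card F) * (real M * (real (card F) / X - q)) \<le> (\<Sum>x\<in>F. D x)" .
  show ?thesis
  proof (rule ccontr)
    assume "\<not> ?thesis"
    then have "(\<Sum>x\<in>F. D x) < (\<Sum>x\<in>F. real M * (real (card F) / X - q))"
      using F by (intro sum_strict_mono) (auto simp: D_def not_le)
    then show False using * by simp
  qed
qed

section \<open>Supersaturation of comparable pairs\<close>

definition grid_comparable :: "nat \<Rightarrow> (nat \<Rightarrow> nat) \<Rightarrow> (nat \<Rightarrow> nat) \<Rightarrow> bool" where
  "grid_comparable n x y \<longleftrightarrow> grid_le n x y \<or> grid_le n y x"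

lemma grid_antichains_eq_indep_sets:
  "grid_antichains t n = indep_sets (grid_comparable n) (hypergrid t n)"
  by (auto simp: grid_antichains_def indep_sets_def grid_comparable_def)

text \<open>The colourings are indexed by blocks of \<open>N\<close> coordinates: two points get the same colour if
  they agree outside the block and lie in the same symmetric chain inside it.\<close>

lemma exists_high_degree_blocks:
  assumes t: "2 \<le> t" and N: "1 \<le> N" "M * N \<le> n" and M: "1 \<le> M"
    and F: "F \<subseteq> hypergrid t n" "F \<noteq> {}"
  shows "\<exists>x\<in>F. real M * (real (card F) / (5 * real t ^ (n - 1) / sqrt (real N)) - 1)
    \<le> real (card {y \<in> F. y \<noteq> x \<and> grid_comparable n x y})"
proof -
  define S where "S b = {b * N..<b * N + N}" for b
  define pt where "pt b x = restrict (\<lambda>i. x (b * N + i)) {..<N}" for b and x :: "nat \<Rightarrow> nat"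
  define key where "key b x = (restrict x ({..<n} - S b), chain_label t N (pt b x))" for b x
  have fin: "finite F" using F finite_hypergrid finite_subset by blast
  have S: "S b \<subseteq> {..<n}" if "b < M" for b
  proof -
    have "Suc b * N \<le> M * N" using that by (intro mult_right_mono) auto
    then show ?thesis using N(2) by (auto simp: S_def)
  qed
  have pt: "pt b x \<in> hypergrid t N" if "b < M" "x \<in> F" for b x
  proof -
    have "x (b * N + i) < t" if "i < N" for i
    proof -
      have "b * N + i \<in> S b" using that by (simp add: S_def)
      then have "b * N + i < n" using S[OF \<open>b < M\<close>] by blast
      then show ?thesis using \<open>x \<in> F\<close> F(1) hypergrid_less by blast
    qed
    then show ?thesis by (auto simp: pt_def hypergrid_def)
  qed
  have outside: "x i = y i" if "key b y = key b x" "i < n" "i \<notin> S b" for b x y i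
    using restrict_eqD[of x "{..<n} - S b" y i] that by (auto simp: key_def)
  have le: "grid_le n x y"
    if b: "b < M" and x: "x \<in> F" and y: "y \<in> F" and eq: "key b y = key b x"
      and s: "(\<Sum>i<N. pt b x i) \<le> (\<Sum>i<N. pt b y i)" for b x y
  proof -
    have "grid_le N (pt b x) (pt b y)"
      using hypergrid_less[OF pt[OF b x]] hypergrid_less[OF pt[OF b y]] eq s
      by (intro chain_label_eq_imp_grid_le[of N _ t]) (auto simp: key_def)
    then have ins: "x (b * N + j) \<le> y (b * N + j)" if "j < N" for j
      using that by (auto simp: grid_le_def pt_def)
    show ?thesis unfolding grid_le_def
    proof (intro allI impI)
      fix i assume "i < n"
      show "x i \<le> y i"
      proof (cases "i \<in> S b")
        case True
        then show ?thesis using ins[of "i - b * N"] by (auto simp: S_def)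
      next
        case False
        then show ?thesis using outside[OF eq \<open>i < n\<close>] by simp
      qed
    qed
  qed
  show ?thesis
  proof (rule exists_high_degree_of_colourings[where key = key and far = "\<lambda>x y. y \<noteq> x"])
    show "0 < 5 * real t ^ (n - 1) / sqrt (real N)" using t N by simp
    fix b assume b: "b < M"
    show "real (card (key b ` F)) \<le> 5 * real t ^ (n - 1) / sqrt (real N)"
    proof -
      let ?P = "({..<n} - S b) \<rightarrow>\<^sub>E {..<t}"
      have "key b ` F \<subseteq> ?P \<times> chain_label t N ` hypergrid t N"
        using pt[OF b] F(1) by (force simp: key_def hypergrid_def)
      then have "card (key b ` F) \<le> card (?P \<times> chain_label t N ` hypergrid t N)"
        by (intro card_mono finite_cartesian_product finite_imageI finite_hypergrid finite_PiE) auto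
      also have "\<dots> = t ^ (n - N) * card (chain_label t N ` hypergrid t N)"
        using S[OF b] by (simp add: card_cartesian_product card_PiE card_Diff_subset S_def)
      also have "\<dots> \<le> t ^ (n - N) * card (grid_layer t N (N * (t - 1) div 2))"
        by (intro mult_left_mono card_chain_labels_le) auto
      finally have "real (card (key b ` F)) \<le> real t ^ (n - N) * real (card (grid_layer t N (N * (t - 1) div 2)))"
        by (simp flip: of_nat_power of_nat_mult)
      also have "\<dots> \<le> real t ^ (n - N) * (5 * real t ^ (N - 1) / sqrt (real N))"
        using card_grid_layer_le[OF t N(1)] by (intro mult_left_mono) auto
      also have "\<dots> = 5 * real t ^ (n - N + (N - 1)) / sqrt (real N)" by (simp add: power_add)
      also have "n - N + (N - 1) = n - 1"
      proof -
        have "1 * N \<le> M * N" using M by (intro mult_right_mono) auto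
        then have "N \<le> n" using N(2) by linarith
        then show ?thesis using N(1) by simp
      qed
      finally show ?thesis .
    qed
    fix x assume x: "x \<in> F"
    \<comment> \<open>Here far means distinct, so only \<open>x\<close> itself is near and
      \<open>q = 1\<close>.\<close>
    have "{y \<in> F. key b y = key b x \<and> \<not> y \<noteq> x} = {x}" using x by auto
    then show "real (card {y \<in> F. key b y = key b x \<and> \<not> y \<noteq> x}) \<le> 1" by simp
    fix y assume y: "y \<in> F" and neq: "y \<noteq> x" and eq: "key b y = key b x"
    show "y \<noteq> x \<and> grid_comparable n x y"
      using le[OF b x y eq] le[OF b y x eq[symmetric]] neq linear by (auto simp: grid_comparable_def)
    fix c assume c: "c < M" and eq': "key c y = key c x"
    \<comment> \<open>Distinct blocks are disjoint, so two points that agree outside each of them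
      agree everywhere.\<close>
    show "b = c"
    proof (rule ccontr)
      assume "b \<noteq> c"
      then have "Suc b * N \<le> c * N \<or> Suc c * N \<le> b * N"
        by (metis Suc_leI linorder_neqE_nat mult_le_mono1)
      then have "S b \<inter> S c = {}" by (auto simp: S_def)
      then have "x i = y i" if "i < n" for i
        using outside[OF eq that] outside[OF eq' that] by blast
      then show False using hypergrid_eqI[of x t n y] x y F(1) neq by blast
    qed
  qed (use fin F in auto)
qed

text \<open>If \<open>p\<close> grows while \<open>q\<close> falls, the numerator grows by at least
  \<open>(m - a) + a = m\<close>, so the quotient changes. A level set of the quotient is therefore
  a chain.\<close>

lemma staircase_div_eq_imp_comparable:
  fixes a m t :: nat
  assumes am: "a \<le> m" and m: "0 < m" and le: "q \<le> t" "q' \<le> t"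
    and eq: "((m - a) * p + a * (t - q)) div m = ((m - a) * p' + a * (t - q')) div m"
  shows "p \<le> p' \<and> q \<le> q' \<or> p' \<le> p \<and> q' \<le> q"
proof -
  have less: "((m - a) * p + a * (t - q)) div m < ((m - a) * p' + a * (t - q')) div m"
    if "p < p'" "q' < q" "q \<le> t" for p q p' q'
  proof -
    have "(m - a) * p + a * (t - q) + m = (m - a) * (p + 1) + a * (t - q + 1)"
    proof -
      obtain d where "m = a + d" using am le_Suc_ex by blast
      then show ?thesis by simp
    qed
    also have "\<dots> \<le> (m - a) * p' + a * (t - q')"
      using that by (intro add_mono mult_left_mono) auto
    finally have "((m - a) * p + a * (t - q) + m) div m \<le> ((m - a) * p' + a * (t - q')) div m"
      by (rule div_le_mono)
    then show ?thesis using m by simp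
  qed
  show ?thesis
    using less[of p p' q' q] less[of p' p q q'] eq le by force
qed

text \<open>Up to a constant the numerator for slope parameter \<open>b\<close> is
  \<open>m * p - b * (p + q)\<close>, and equal quotients keep its change below \<open>m\<close>.
  Subtracting the cases \<open>a\<close> and \<open>c\<close> cancels \<open>p\<close>:
  \<open>c - a \<ge> 1\<close> times the change of \<open>p + q\<close> is below
  \<open>2 * m\<close>.\<close>

lemma staircase_div_eq_imp_close:
  fixes a c m t :: nat
  assumes ac: "a < c" and cm: "c \<le> m" and m: "0 < m" and le: "q \<le> t" "q' \<le> t"
    and eqa: "((m - a) * p + a * (t - q)) div m = ((m - a) * p' + a * (t - q')) div m"
    and eqc: "((m - c) * p + c * (t - q)) div m = ((m - c) * p' + c * (t - q')) div m"
  shows "p + q < p' + q' + 2 * m"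
proof -
  have close: "\<bar>int f - int g\<bar> < int m" if "f div m = g div m" for f g
  proof -
    have "int f - int g = int (f mod m) - int (g mod m)"
      using that div_mult_mod_eq[of f m] div_mult_mod_eq[of g m]
      by (metis add_diff_cancel_left of_nat_add)
    moreover have "f mod m < m" "g mod m < m" using m by auto
    ultimately show ?thesis by linarith
  qed
  have "int ((m - b) * p + b * (t - q)) - int ((m - b) * p' + b * (t - q'))
      = int m * (int p - int p') - int b * (int (p + q) - int (p' + q'))" if "b \<le> m" for b
    unfolding of_nat_add of_nat_mult of_nat_diff[OF that] of_nat_diff[OF le(1)] of_nat_diff[OF le(2)]
    by (simp add: algebra_simps)
  from this[of a] this[of c] close[OF eqa] close[OF eqc] ac cm
  have "\<bar>int c * (int (p + q) - int (p' + q')) - int a * (int (p + q) - int (p' + q'))\<bar> < 2 * int m"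
    by linarith
  then have *: "(int c - int a) * (int (p + q) - int (p' + q')) < 2 * int m"
    by (simp add: algebra_simps)
  show ?thesis
  proof (rule ccontr)
    assume "\<not> ?thesis"
    then have "int (p + q) - int (p' + q') \<ge> 2 * int m" by linarith
    then have "(int c - int a) * (int (p + q) - int (p' + q')) \<ge> 1 * (2 * int m)"
      using ac by (intro mult_mono) auto
    then show False using * by linarith
  qed
qed

text \<open>The colour classes of the \<open>a\<close>-th colouring are staircases of slope \<open>(m - a) : a\<close>
  in the plane of the first two coordinates; staircases of different slopes separate quickly.\<close>

lemma exists_high_degree_staircases:
  assumes t: "1 \<le> t" and n: "2 \<le> n" and m: "1 \<le> m" and F: "F \<subseteq> hypergrid t n" "F \<noteq> {}"
  shows "\<exists>x\<in>F. real m * (real (card F) / (real (t + 1) * real t ^ (n - 2)) - 4 * real m)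
    \<le> real (card {y \<in> F. y \<noteq> x \<and> grid_comparable n x y})"
proof -
  define key where "key a x = (((m - a) * x 0 + a * (t - x 1)) div m, restrict x {2..<n})"
    for a and x :: "nat \<Rightarrow> nat"
  define far where "far x y \<longleftrightarrow> x 0 + x 1 + 2 * m \<le> y 0 + y 1 \<or> y 0 + y 1 + 2 * m \<le> x 0 + x 1"
    for x y :: "nat \<Rightarrow> nat"
  have fin: "finite F" using F finite_hypergrid finite_subset by blast
  have bd: "x i < t" if "x \<in> F" "i < n" for x i
    using that F(1) hypergrid_less by blast
  have b01: "x 0 < t" "x 1 < t" if "x \<in> F" for x using bd[OF that] n by auto
  have outside: "x i = y i" if "key a y = key a x" "2 \<le> i" "i < n" for a x y i
    using restrict_eqD[of x "{2..<n}" y i] that by (auto simp: key_def)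
  have comp: "x 0 \<le> y 0 \<and> x 1 \<le> y 1 \<or> y 0 \<le> x 0 \<and> y 1 \<le> x 1"
    if "a < m" "x \<in> F" "y \<in> F" "key a y = key a x" for a x y
    using staircase_div_eq_imp_comparable[of a m "x 1" t "y 1" "x 0" "y 0"] that b01[of x] b01[of y]
    by (auto simp: key_def)
  have split: "i = 0 \<or> i = 1 \<or> 2 \<le> i" for i :: nat by auto
  show ?thesis
  proof (rule exists_high_degree_of_colourings[where key = key and far = far])
    show "0 < real (t + 1) * real t ^ (n - 2)" using t by simp
    fix a assume a: "a < m"
    show "real (card (key a ` F)) \<le> real (t + 1) * real t ^ (n - 2)"
    proof -
      \<comment> \<open>The numerator is at most \<open>m * t\<close>, so the staircase index takes
        at most \<open>t + 1\<close> values.\<close>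
      have "key a x \<in> {..t} \<times> ({2..<n} \<rightarrow>\<^sub>E {..<t})" if x: "x \<in> F" for x
      proof -
        have "(m - a) * x 0 + a * (t - x 1) \<le> (m - a) * t + a * t"
          using b01[OF x] by (intro add_mono mult_left_mono) auto
        also have "\<dots> = m * t" using a by (simp flip: add_mult_distrib)
        finally have "((m - a) * x 0 + a * (t - x 1)) div m \<le> (m * t) div m" by (rule div_le_mono)
        then show ?thesis using m bd[OF x] by (auto simp: key_def)
      qed
      then have "key a ` F \<subseteq> {..t} \<times> ({2..<n} \<rightarrow>\<^sub>E {..<t})" by blast
      then have "card (key a ` F) \<le> card ({..t} \<times> ({2..<n} \<rightarrow>\<^sub>E {..<t}))"
        by (intro card_mono finite_cartesian_product finite_PiE) auto
      also have "\<dots> = (t + 1) * t ^ (n - 2)" by (simp add: card_cartesian_product card_PiE)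
      finally have "real (card (key a ` F)) \<le> real ((t + 1) * t ^ (n - 2))" by (simp only: of_nat_le_iff)
      then show ?thesis by (simp only: of_nat_mult of_nat_power)
    qed
    fix x assume x: "x \<in> F"
    show "real (card {y \<in> F. key a y = key a x \<and> \<not> far x y}) \<le> 4 * real m"
    proof -
      let ?N = "{y \<in> F. key a y = key a x \<and> \<not> far x y}"
      \<comment> \<open>Within a colour class, a chain, the sum of the first two coordinates
        determines the point; points not far from \<open>x\<close> have sums in a window of fewer
        than \<open>4 * m\<close> integers.\<close>
      have "inj_on (\<lambda>y. y 0 + y 1) ?N"
      proof (rule inj_onI)
        fix y z assume y: "y \<in> ?N" and z: "z \<in> ?N" and s: "y 0 + y 1 = z 0 + z 1"
        have eq: "key a z = key a y" using y z by simp
        have "y 0 = z 0 \<and> y 1 = z 1" using comp[OF a _ _ eq] y z s by auto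
        then have "y i = z i" if "i < n" for i
          using outside[OF eq _ that] split[of i] by auto
        then show "y = z" using y z F(1) by (intro hypergrid_eqI[of y t n z]) auto
      qed
      moreover have "(\<lambda>y. y 0 + y 1) ` ?N \<subseteq> {x 0 + x 1 + 1 - 2 * m..<x 0 + x 1 + 2 * m}"
        by (auto simp: far_def)
      ultimately have "card ?N \<le> card {x 0 + x 1 + 1 - 2 * m..<x 0 + x 1 + 2 * m}"
        by (intro card_inj_on_le) auto
      also have "\<dots> \<le> 4 * m" by simp
      finally have "real (card ?N) \<le> real (4 * m)" by (simp only: of_nat_le_iff)
      then show ?thesis by simp
    qed
    fix y assume y: "y \<in> F" and far: "far x y" and eq: "key a y = key a x"
    have "grid_le n x y \<or> grid_le n y x"
    proof -
      have "x i \<le> y i" if "x 0 \<le> y 0" "x 1 \<le> y 1" "i < n" for i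
        using that outside[OF eq _ that(3)] split[of i] by auto
      moreover have "y i \<le> x i" if "y 0 \<le> x 0" "y 1 \<le> x 1" "i < n" for i
        using that outside[OF eq _ that(3)] split[of i] by auto
      ultimately show ?thesis using comp[OF a x y eq] by (auto simp: grid_le_def)
    qed
    then show "y \<noteq> x \<and> grid_comparable n x y"
      using far m by (auto simp: far_def grid_comparable_def)
    fix c assume c: "c < m" and eq': "key c y = key c x"
    have "\<not> far x y" if "a < c" "c < m" "key a y = key a x" "key c y = key c x" for a c
      using staircase_div_eq_imp_close[of a c m "x 1" t "y 1" "x 0" "y 0"]
        staircase_div_eq_imp_close[of a c m "y 1" t "x 1" "y 0" "x 0"]
        that b01[OF x] b01[OF y] m by (auto simp: key_def far_def)
    then show "a = c" using far a c eq eq' by (metis linorder_neqE_nat)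
  qed (use fin F in auto)
qed

text \<open>Here \<open>K = r ^ 4\<close>. About \<open>r\<^sup>2\<close> colourings with
  \<open>O(r * w)\<close> classes each, \<open>w\<close> being the width, give average classes of
  order \<open>r ^ 3\<close> and degrees of order \<open>r ^ 5\<close>. Blocks need
  \<open>n \<ge> m\<close>; otherwise \<open>sqrt n \<le> r\<close> makes the staircases cheap
  enough.\<close>

lemma exists_high_degree:
  fixes r :: real
  assumes t: "2 \<le> t" and n: "2 \<le> n" and F: "F \<subseteq> hypergrid t n"
    and r: "128 \<le> r" and large: "r ^ 4 * real (grid_width t n) \<le> real (card F)"
  shows "\<exists>x\<in>F. r ^ 5 / 240 \<le> real (card {y \<in> F. y \<noteq> x \<and> grid_comparable n x y})"
proof -
  define w where "w = real (grid_width t n)"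
  have width: "real t ^ (n - 1) \<le> 8 * sqrt (real n) * w"
    using grid_width_ge[of n t] t n by (simp add: w_def field_simps)
  have "0 < real t ^ (n - 1)" using t by simp
  then have "0 < 8 * sqrt (real n) * w" using width by linarith
  then have w: "0 < w" using n by (simp add: zero_less_mult_iff)
  have F0: "F \<noteq> {}" using large w r unfolding w_def[symmetric] by (auto simp: mult_le_0_iff)
  define m where "m = nat \<lfloor>r\<^sup>2\<rfloor>"
  have r2: "r\<^sup>2 \<ge> 16384" using power_mono[OF r, of 2] by simp
  have m: "real m \<le> r\<^sup>2" "r\<^sup>2 / 2 \<le> real m" "1 \<le> m"
    using r2 by (auto simp: m_def le_nat_iff le_floor_iff) linarith
  have r3: "r ^ 3 \<ge> 128 * r\<^sup>2" using r mult_right_mono[OF r, of "r\<^sup>2"] by (simp add: power3_eq_cube power2_eq_square)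
  show ?thesis
  proof (cases "r\<^sup>2 \<le> real n")
    case True
    then have mn: "m \<le> n" using m by linarith
    \<comment> \<open>Rounding costs a factor 2 only: \<open>n \<le> 2 * m * N\<close>. Thus
      \<open>sqrt n = O(r * sqrt N)\<close>, which turns the class bound \<open>X\<close> into
      \<open>O(r * w)\<close>.\<close>
    define N where "N = n div m"
    have N: "1 \<le> N" "m * N \<le> n"
      using mn m by (auto simp: N_def Suc_le_eq div_greater_zero_iff)
    have "n < m * (N + 1)" using m(3) dividend_less_times_div[of m n] by (simp add: N_def)
    also have "\<dots> \<le> m * (2 * N)" using N by (intro mult_left_mono) auto
    finally have "real n < real (m * (2 * N))" by (simp only: of_nat_less_iff)
    then have "real n \<le> 2 * real m * real N" by simp
    also have "\<dots> \<le> (3 / 2 * r)\<^sup>2 * real N"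
      using m by (intro mult_right_mono) (auto simp: power2_eq_square)
    finally have "sqrt (real n) \<le> sqrt ((3 / 2 * r)\<^sup>2 * real N)" by simp
    also have "\<dots> = 3 / 2 * r * sqrt (real N)" using r by (simp add: real_sqrt_mult)
    finally have sn: "sqrt (real n) \<le> 3 / 2 * r * sqrt (real N)" .
    define X where "X = 5 * real t ^ (n - 1) / sqrt (real N)"
    have X0: "0 < X" using t N by (simp add: X_def)
    have "5 * real t ^ (n - 1) \<le> 40 * w * sqrt (real n)" using width by (simp add: mult_ac)
    also have "\<dots> \<le> 40 * w * (3 / 2 * r * sqrt (real N))" using sn w by (intro mult_left_mono) auto
    finally have X: "X \<le> 60 * r * w" using N by (simp add: X_def field_simps)
    have "r ^ 3 / 60 * X \<le> r ^ 3 / 60 * (60 * r * w)" using X r by (intro mult_left_mono) auto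
    also have "\<dots> = r ^ 4 * w" by (simp add: power_def numeral_eq_Suc)
    also have "\<dots> \<le> real (card F)" using large by (simp add: w_def)
    finally have "r ^ 3 / 60 \<le> real (card F) / X" using X0 by (simp add: field_simps)
    then have "r ^ 3 / 120 \<le> real (card F) / X - 1" using r3 r2 by linarith
    then have "(r\<^sup>2 / 2) * (r ^ 3 / 120) \<le> real m * (real (card F) / X - 1)"
      using m r by (intro mult_mono) auto
    moreover have "(r\<^sup>2 / 2) * (r ^ 3 / 120) = r ^ 5 / 240" by (simp flip: power_add)
    ultimately show ?thesis
      using exists_high_degree_blocks[OF t N m(3) F F0] unfolding X_def by force
  next
    case False
    define X where "X = real (t + 1) * real t ^ (n - 2)"
    have X0: "0 < X" using t by (simp add: X_def)
    have sn: "sqrt (real n) \<le> r" using False r by (intro real_le_lsqrt) auto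
    have "X \<le> 2 * real t * real t ^ (n - 2)" unfolding X_def using t by (intro mult_right_mono) auto
    also have "\<dots> = 2 * real t ^ Suc (n - 2)" by simp
    also have "Suc (n - 2) = n - 1" using n by simp
    also have "2 * real t ^ (n - 1) \<le> 16 * w * sqrt (real n)" using width by (simp add: mult_ac)
    also have "\<dots> \<le> 16 * w * r" using sn w by (intro mult_left_mono) auto
    finally have X: "X \<le> 16 * w * r" .
    have "r ^ 3 / 16 * X \<le> r ^ 3 / 16 * (16 * w * r)" using X r by (intro mult_left_mono) auto
    also have "\<dots> = r ^ 4 * w" by (simp add: power_def numeral_eq_Suc)
    also have "\<dots> \<le> real (card F)" using large by (simp add: w_def)
    finally have "r ^ 3 / 16 \<le> real (card F) / X" using X0 by (simp add: field_simps)
    \<comment> \<open>The close pairs cost \<open>4 * m \<le> 4 * r\<^sup>2\<close>, which is at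
      most \<open>r ^ 3 / 32\<close> because \<open>r \<ge> 128\<close>.\<close>
    then have "r ^ 3 / 120 \<le> real (card F) / X - 4 * real m" using r3 r2 m(1) by linarith
    then have "(r\<^sup>2 / 2) * (r ^ 3 / 120) \<le> real m * (real (card F) / X - 4 * real m)"
      using m r by (intro mult_mono) auto
    moreover have "(r\<^sup>2 / 2) * (r ^ 3 / 120) = r ^ 5 / 240" by (simp flip: power_add)
    ultimately have deg: "r ^ 5 / 240 \<le> real m * (real (card F) / X - 4 * real m)" by linarith
    have "1 \<le> t" using t by simp
    from exists_high_degree_staircases[OF this n m(3) F F0]
    obtain x where "x \<in> F" "real m * (real (card F) / X - 4 * real m)
        \<le> real (card {y \<in> F. y \<noteq> x \<and> grid_comparable n x y})"
      unfolding X_def by blast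
    then show ?thesis using deg order_trans by blast
  qed
qed

section \<open>Counting small antichains\<close>

text \<open>Comparison with an integral: by the mean value theorem each term is at most 8 times a
  drop of \<open>u powr (- 1/8)\<close>, and the drops telescope.\<close>

lemma sum_powr_tail_le:
  assumes v: "1 \<le> v"
  shows "(\<Sum>u=v+1..V. real u powr (- 9/8)) \<le> 8 * real v powr (- 1/8)"
proof (cases "v \<le> V")
  case True
  have step: "real (Suc u) powr (- 9/8) \<le> 8 * (real u powr (- 1/8) - real (Suc u) powr (- 1/8))"
    if u: "1 \<le> u" for u
  proof -
    have "\<exists>z. real u < z \<and> z < real (Suc u) \<and> real (Suc u) powr (- 1/8) - real u powr (- 1/8) =
        (real (Suc u) - real u) * (- 1/8 * z powr (- 1/8 - 1))"
      using u by (intro MVT2) (auto intro!: derivative_eq_intros)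
    then obtain z where z: "real u < z" "z < real (Suc u)"
      "real (Suc u) powr (- 1/8) - real u powr (- 1/8) = (real (Suc u) - real u) * (- 1/8 * z powr (- 1/8 - 1))"
      by blast
    have "real (Suc u) powr (- 9/8) \<le> z powr (- 9/8)"
      using z u by (intro powr_mono2') auto
    then show ?thesis using z(3) by simp
  qed
  have "(\<Sum>u=v+1..V. real u powr (- 9/8)) \<le> 8 * (real v powr (- 1/8) - real V powr (- 1/8))"
    using True
  proof (induction V rule: dec_induct)
    case (step V)
    then show ?case using \<open>\<And>u. 1 \<le> u \<Longrightarrow> _\<close>[of V] v by simp
  qed simp
  also have "\<dots> \<le> 8 * real v powr (- 1/8)" by simp
  finally show ?thesis .
qed simp

lemma exp_minus_le_fact_div_power:
  fixes r :: real
  assumes "0 < r"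
  shows "exp (- r) \<le> fact k / r ^ k"
proof -
  have "(\<Sum>n\<in>{k}. r ^ n /\<^sub>R fact n) \<le> exp r"
    unfolding exp_def using assms by (intro sum_le_suminf summable_exp_generic) auto
  then show ?thesis using assms by (simp add: exp_minus field_simps)
qed

lemma card_small_antichains_le:
  assumes n: "2 \<le> n" and t: "2 \<le> t" and k: "2 \<le> k"
  shows "real (card {A \<in> grid_antichains t n. real (card A) \<le> (1 / real k) * real (grid_width t n)})
    \<le> 2 powr ((2 * 10 ^ 11) * (log 2 (real k) / real k) * real (grid_width t n))"
proof -
  let ?H = "hypergrid t n" and ?R = "grid_comparable n"
  define w where "w = real (grid_width t n)"
  define \<mu> where "\<mu> = 1 / real k ^ 9"
  \<comment> \<open>With \<open>r = (u / w) powr (1/8)\<close> the available degree is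
    \<open>r ^ 10 / 240\<close>. Taking \<open>\<delta>\<close> of order \<open>1 / r ^ 9\<close>
    makes degree times \<open>\<delta>\<close> at least \<open>r\<close>, and
    \<open>exp (- r)\<close> is again \<open>O(1 / r ^ 9)\<close>. The exponent 9/8 exceeds 1, so
    the tail is summable.\<close>
  define \<delta> where "\<delta> u = min \<mu> (10 ^ 10 * (real u / w) powr (- 9/8))" for u
  have k0: "0 < real k" using k by simp
  have \<mu>: "0 < \<mu>" "\<mu> \<le> 1" using k by (auto simp: \<mu>_def)
  have "0 < real t ^ (n - 1) / (8 * sqrt (real n))" using t n by simp
  also have "\<dots> \<le> w" unfolding w_def using n t by (intro grid_width_ge) auto
  finally have w0: "0 < w" .
  then have w1: "1 \<le> w" by (simp add: w_def)
  have gf: "indep_gf ?R \<mu> ?H \<le> exp (\<Sum>u=1..card ?H. \<delta> u)"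
  proof (rule indep_gf_le_exp)
    show "\<delta> v \<le> \<delta> u" if "1 \<le> u" "u \<le> v" for u v
    proof -
      have "(real v / w) powr (- 9/8) \<le> (real u / w) powr (- 9/8)"
        using that w0 by (intro powr_mono2') (auto simp: divide_right_mono)
      then show ?thesis unfolding \<delta>_def by (intro min.mono) auto
    qed
    show "0 \<le> \<delta> u" for u using \<mu> by (simp add: \<delta>_def)
    fix F assume F: "F \<subseteq> ?H" "F \<noteq> {}"
    show "\<mu> \<le> \<delta> (card F) \<or>
      (\<exists>x\<in>F. \<mu> * exp (- real (card {y \<in> F. y \<noteq> x \<and> ?R x y}) * \<delta> (card F)) \<le> \<delta> (card F))"
    proof (cases "\<mu> \<le> \<delta> (card F)")
      case False
      define r where "r = (real (card F) / w) powr (1/8)"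
      have "finite F" using F finite_hypergrid finite_subset by blast
      then have cF: "0 < real (card F)" using F by (simp add: card_gt_0_iff)
      then have r0: "0 < r" using w0 by (simp add: r_def)
      have pow: "r ^ j = (real (card F) / w) powr (real j / 8)" for j
        using cF w0 by (simp add: r_def powr_realpow[symmetric] powr_powr)
      have r8: "r ^ 8 = real (card F) / w" using cF w0 by (simp add: pow)
      have \<delta>: "\<delta> (card F) = 10 ^ 10 / r ^ 9" "10 ^ 10 / r ^ 9 < 1"
      proof -
        have "(real (card F) / w) powr (- 9/8) = 1 / r ^ 9"
          using pow[of 9] powr_minus_divide[of "real (card F) / w" "9/8"] by simp
        then have "\<delta> (card F) = min \<mu> (10 ^ 10 / r ^ 9)" by (simp add: \<delta>_def)
        then show "\<delta> (card F) = 10 ^ 10 / r ^ 9" "10 ^ 10 / r ^ 9 < 1" using False \<mu> by linarith+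
      qed
      \<comment> \<open>A value of \<open>\<delta>\<close> below 1 forces
        \<open>r ^ 9 > 10 ^ 10 > 12 ^ 9\<close>; then \<open>r\<^sup>2 \<ge> 144\<close> clears the
        threshold 128 of \<open>exists_high_degree\<close>.\<close>
      have r12: "12 \<le> r"
      proof (rule ccontr)
        assume "\<not> ?thesis"
        then have "r ^ 9 \<le> 12 ^ 9" using r0 by (intro power_mono) auto
        moreover have "10 ^ 10 < r ^ 9" using \<delta>(2) r0 by (simp add: field_simps)
        ultimately show False by simp
      qed
      have "(r\<^sup>2) ^ 4 = r ^ 8" by (simp flip: power_mult)
      then have "(r\<^sup>2) ^ 4 * w \<le> real (card F)" using r8 w0 by simp
      moreover have "128 \<le> r\<^sup>2" using power_mono[OF r12, of 2] by simp
      ultimately obtain x where x: "x \<in> F" "(r\<^sup>2) ^ 5 / 240 \<le> real (card {y \<in> F. y \<noteq> x \<and> ?R x y})"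
        using exists_high_degree[OF t n F(1), of "r\<^sup>2"] unfolding w_def by blast
      \<comment> \<open>The constant \<open>10 ^ 10\<close> dominates both the 240 here and
        \<open>fact 9\<close> below.\<close>
      have "r \<le> r ^ 10 / 240 * (10 ^ 10 / r ^ 9)"
        using r0 by (simp add: power_def numeral_eq_Suc)
      also have "\<dots> \<le> real (card {y \<in> F. y \<noteq> x \<and> ?R x y}) * \<delta> (card F)"
        unfolding \<delta>(1) using x(2) r0 by (intro mult_right_mono) (auto simp flip: power_mult)
      finally have "\<mu> * exp (- real (card {y \<in> F. y \<noteq> x \<and> ?R x y}) * \<delta> (card F)) \<le> 1 * exp (- r)"
        using \<mu> by (intro mult_mono) auto
      also have "\<dots> \<le> fact 9 / r ^ 9" using exp_minus_le_fact_div_power[OF r0, of 9] by simp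
      also have "\<dots> \<le> 10 ^ 10 / r ^ 9"
        using r0 by (intro divide_right_mono) (auto simp: fact_numeral)
      finally show ?thesis using x(1) \<delta>(1) by auto
    qed simp
  qed (use \<mu> finite_hypergrid in auto)
  have sum: "(\<Sum>u=1..V. \<delta> u) \<le> (1 + 8 * 10 ^ 10) * (w / real k)" for V
  proof -
    \<comment> \<open>At \<open>u = w * k ^ 8\<close> the power \<open>(u / w) powr (- 9/8)\<close>
      equals \<open>\<mu>\<close>. Up to \<open>v\<close> the bound \<open>\<mu>\<close> is summed,
      beyond it the tail; each part is \<open>O(w / k)\<close>.\<close>
    define v where "v = grid_width t n * k ^ 8"
    have v: "real v = w * real k ^ 8" "1 \<le> v" using w1 k by (auto simp: v_def w_def)
    have "(\<Sum>u=1..V. \<delta> u) \<le> (\<Sum>u\<in>{1..v} \<union> {v+1..V}. \<delta> u)"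
      using \<mu> by (intro sum_mono2) (auto simp: \<delta>_def)
    also have "\<dots> = (\<Sum>u=1..v. \<delta> u) + (\<Sum>u=v+1..V. \<delta> u)"
      by (intro sum.union_disjoint) auto
    also have "(\<Sum>u=1..v. \<delta> u) \<le> (\<Sum>u=1..v. \<mu>)"
      by (intro sum_mono) (simp add: \<delta>_def)
    also have "(\<Sum>u=1..v. \<mu>) = w / real k"
      using k0 by (simp add: v \<mu>_def power_def numeral_eq_Suc)
    also have "(\<Sum>u=v+1..V. \<delta> u) \<le> (\<Sum>u=v+1..V. 10 ^ 10 * w powr (9/8) * real u powr (- 9/8))"
    proof (rule sum_mono)
      fix u
      have "(real u / w) powr (- 9/8) = real u powr (- 9/8) * w powr (9/8)"
        using w0 by (simp add: powr_divide powr_minus_divide)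
      then show "\<delta> u \<le> 10 ^ 10 * w powr (9/8) * real u powr (- 9/8)"
        by (simp add: \<delta>_def min_le_iff_disj)
    qed
    also have "\<dots> = 10 ^ 10 * w powr (9/8) * (\<Sum>u=v+1..V. real u powr (- 9/8))"
      by (simp add: sum_distrib_left)
    also have "\<dots> \<le> 10 ^ 10 * w powr (9/8) * (8 * real v powr (- 1/8))"
      using sum_powr_tail_le[OF v(2)] by (intro mult_left_mono) auto
    also have "real v powr (- 1/8) = w powr (- 1/8) * (1 / real k)"
    proof -
      have "(real k ^ 8) powr (- 1/8) = 1 / real k"
      proof -
        have "real k ^ 8 = real k powr 8" using powr_realpow[OF k0, of 8] by simp
        then have "(real k ^ 8) powr (- 1/8) = real k powr (8 * (- 1/8))" by (simp only: powr_powr)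
        then show ?thesis using k0 by (simp add: powr_minus_divide)
      qed
      then show ?thesis unfolding v(1) using w0 by (simp add: powr_mult)
    qed
    also have "10 ^ 10 * w powr (9/8) * (8 * (w powr (- 1/8) * (1 / real k))) = 8 * 10 ^ 10 * (w powr (9/8 + - 1/8) / real k)"
      unfolding powr_add by simp
    also have "w powr (9/8 + - 1/8) = w" using w0 by simp
    finally show ?thesis by (simp add: algebra_simps)
  qed
  have "real (card {A \<in> grid_antichains t n. real (card A) \<le> w / real k}) \<le> \<mu> powr (- (w / real k)) * indep_gf ?R \<mu> ?H"
    unfolding grid_antichains_eq_indep_sets
    using \<mu> w0 k0 finite_hypergrid by (intro card_small_indep_sets_le) auto
  also have "\<dots> \<le> \<mu> powr (- (w / real k)) * exp ((1 + 8 * 10 ^ 10) * (w / real k))"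
    using gf sum[of "card ?H"] by (intro mult_left_mono) (auto intro: order_trans)
  also have "\<mu> powr (- (w / real k)) = 2 powr (9 * log 2 (real k) * (w / real k))"
    using k0 by (simp add: powr_def \<mu>_def ln_div ln_realpow log_def)
  \<comment> \<open>Change of base by \<open>2 * ln 2 \<ge> 1\<close>; since
    \<open>k \<ge> 2\<close>, the factor \<open>log 2 k \<ge> 1\<close> may be inserted.\<close>
  also have "exp ((1 + 8 * 10 ^ 10) * (w / real k)) \<le> 2 powr (2 * (1 + 8 * 10 ^ 10) * log 2 (real k) * (w / real k))"
  proof -
    have "1 \<le> log 2 (real k)" using k by simp
    moreover have "1 \<le> 2 * ln (2::real)" using ln2_ge_two_thirds by linarith
    ultimately have "1 * 1 \<le> log 2 (real k) * (2 * ln 2)" by (intro mult_mono) auto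
    then have "(1 + 8 * 10 ^ 10) * (w / real k) * 1 \<le> (1 + 8 * 10 ^ 10) * (w / real k) * (log 2 (real k) * (2 * ln 2))"
      using w0 k0 by (intro mult_left_mono) auto
    then show ?thesis by (simp add: powr_def algebra_simps)
  qed
  also have "2 powr (9 * log 2 (real k) * (w / real k)) * 2 powr (2 * (1 + 8 * 10 ^ 10) * log 2 (real k) * (w / real k))
      = 2 powr ((9 + 2 * (1 + 8 * 10 ^ 10)) * (log 2 (real k) * (w / real k)))"
    unfolding powr_add[symmetric] by (simp add: algebra_simps)
  also have "\<dots> \<le> 2 powr (2 * 10 ^ 11 * (log 2 (real k) * (w / real k)))"
    using w0 k0 k by (intro powr_mono mult_right_mono) auto
  finally show ?thesis by (simp add: w_def mult.assoc)
qed

theorem theorem2p2: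
  shows "\<exists>C::real. C > 0 \<and>
    (\<forall>(n::nat) (t::nat) (k::nat). n \<ge> 2 \<longrightarrow> t \<ge> 2 \<longrightarrow> k \<ge> 2 \<longrightarrow>
      real (card {A \<in> grid_antichains t n.
                    real (card A) \<le> (1 / real k) * real (grid_width t n)})
        \<le> 2 powr (C * (log 2 (real k) / real k) * real (grid_width t n)))"
  using card_small_antichains_le by (intro exI[of _ "2 * 10 ^ 11"]) auto

end
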